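(* Let $m\ge1$ and let $\beta=(\beta_1,\beta_2)$, $\gamma=(\gamma_0,\dots,\gamma_m)$ consist of positive integers with $\beta_1+\beta_2=\sum_{i=0}^m\gamma_i$. With $F$, $F^{(k)}$, $P_{m+1}$, $P_0$ and the sets $\mathcal{B}_0,\dots,\mathcal{B}_m$ as in the context: (1) If $(\beta,\gamma)\in\mathcal{B}_0$, then the relation $$F(a-1,b,c;x)=\frac{a-1}{c-a}\cdot P_{m+1}(a,b,c;x)\cdot F(a,b,c;x),$$ valid for generic parameters, also holds when the parameters are specialized to the integral point $(a,b,c)=(-\beta_1,(-\gamma_1,\dots,-\gamma_m),\gamma_0-\beta_1+1)$. (2) Let $1\le k\le m$ and $(\beta,\gamma)\in\mathcal{B}_k$. If also $(\beta_1+1,\beta_2-1,\gamma_0,\dots,\gamma_m)\in\mathcal{B}_k$, then the relation $$F^{(k)}(a-1,b,c-1;x)=-P_0(a,b,c;x)\cdot F^{(k)}(a,b,c;x),$$ valid for generic parameters, also holds when the parameters are specialized to the integral point $(a,b,c)=(-\beta_1,(-\gamma_1,\dots,-\gamma_m),\gamma_0-\beta_1+1)$.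
   Context: Sets: $\mathcal{B}_0=\{(\beta_1,\beta_2,\gamma_0,\dots,\gamma_m)\in(\mathbb{Z}_{>0})^{m+3}\mid\beta_1+\beta_2=\sum_{i=0}^m\gamma_i,\ \beta_1-\gamma_0\le0\}$ and, for $1\le k\le m$, $\mathcal{B}_k=\{(\beta_1,\beta_2,\gamma_0,\dots,\gamma_m)\in(\mathbb{Z}_{>0})^{m+3}\mid\beta_1+\beta_2=\sum_{i=0}^m\gamma_i,\ \beta_1-\sum_{i=0}^{k-1}\gamma_i>0,\ \beta_1-\sum_{i=0}^{k}\gamma_i\le0\}$. Lauricella's series: $F_D(a,b,c;x)=\sum_{n_1,\dots,n_m\ge0}\frac{(a,n_1+\cdots+n_m)(b_1,n_1)\cdots(b_m,n_m)}{(c,n_1+\cdots+n_m)n_1!\cdots n_m!}x_1^{n_1}\cdots x_m^{n_m}$, with $(a,n)=a(a+1)\cdots(a+n-1)$. For $1\le k\le m$, $$f^{(k)}(a,b,c;x)=\prod_{l=1}^{k-1}x_l^{-b_l}\cdot x_k^{\sum_{l=1}^{k-1}b_l-c+1}\sum_{n_1,\dots,n_m\ge0}\frac{1}{\Gamma^{(k)}_{n_1,\dots,n_m}(a,b,c)}\prod_{l=1}^{k-1}\Big(\frac{x_k}{x_l}\Big)^{n_l}x_k^{n_k}\prod_{l=k+1}^m\Big(\frac{x_l}{x_k}\Big)^{n_l},$$ where $\Gamma^{(k)}_{n_1,\dots,n_m}(a,b,c)=\Gamma(c-a-n_k)\prod_{1\le l\le m,\,l\ne k}\Gamma(1-b_l-n_l)\prod_{l=1}^m\Gamma(1+n_l)\cdot\Gamma\big(-\sum_{l=1}^kb_l+c-\sum_{l=1}^kn_l+\sum_{l=k+1}^mn_l\big)\cdot\Gamma\big(2+\sum_{l=1}^{k-1}b_l-c+\sum_{l=1}^kn_l-\sum_{l=k+1}^mn_l\big)$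 and $1/\Gamma$ is understood as an entire function (zero at non-positive integers). At the integral parameters occurring in the claim these series are finite sums, so $F_D$ is a polynomial in $x$ and $f^{(k)}$ is a Laurent polynomial in $x$ (with all $x_i\neq0$); their values are the limits from generic parameters. Vectors: $F(a,b,c;x)={}^t(F_D,\frac{x_1-1}{-b_1}\frac{\partial F_D}{\partial x_1},\dots,\frac{x_m-1}{-b_m}\frac{\partial F_D}{\partial x_m})$ and $F^{(k)}(a,b,c;x)={}^t(f^{(k)},\frac{x_1-1}{-b_1}\frac{\partial f^{(k)}}{\partial x_1},\dots,\frac{x_m-1}{-b_m}\frac{\partial f^{(k)}}{\partial x_m})$, evaluated at $(a,b,c;x)$. Matrices (rows and columns indexed $0,\dots,m$): put $x_0=0$, $x_{m+1}=1$, $\alpha_0=-c+\sum_{j=1}^mb_j$, $\alpha_j=-b_j$ $(1\le j\le m)$, $\alpha_{m+1}=c-a$, $\alpha_{m+2}=a$, $N$ the all-ones $(m+1)\times(m+1)$ matrix. Then $C(a,b,c)=2\pi\sqrt{-1}\{\frac1{\alpha_{m+1}}N+\mathrm{diag}(\frac1{\alpha_{m+2}},\frac1{\alpha_1},\dots,\frac1{\alpha_m})\}$; $Q_k(a,b,c;x)=2\pi\sqrt{-1}\{\frac{1-x_k}{\alpha_{m+1}}N+\frac1{\alpha_{m+2}}\mathrm{diag}(0,1-x_1,\dots,1-x_m)\,N\,\mathrm{diag}(1,0,\dots,0)-\frac1{1-\alpha_{m+2}}\mathrm{diag}(1,0,\dots,0)\,N\,\mathrm{diag}(0,1-x_1,\dots,1-x_m)+\mathrm{diag}(\frac{1-x_k}{\alpha_{m+2}}-\frac1{1-\alpha_{m+2}}(\frac{\sum_{p=1}^{m+1}\alpha_px_p}{\alpha_{m+2}}+1),\frac{x_1-x_k}{\alpha_1},\dots,\frac{x_m-x_k}{\alpha_m})\}$;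 $P_k(a,b,c;x)=Q_k(a,b,c;x)\,C(a,b,c)^{-1}$ for $0\le k\le m+1$. *)

theory Defs
  imports
    "HOL-Analysis.Analysis"
    "Jordan_Normal_Form.Gauss_Jordan_Elimination"
begin

text \<open>
  The parameters \<open>b\<close> and the variables \<open>x\<close> are functions on \<open>nat\<close> of which only the values at
  \<open>1, \<dots>, m\<close> matter, and \<open>\<gamma>\<close> is one of which only the values at \<open>0, \<dots>, m\<close> matter.
\<close>

definition \<B> :: "nat \<Rightarrow> nat \<Rightarrow> (int \<times> int \<times> (nat \<Rightarrow> int)) set" where
  "\<B> m k = {(\<beta>1, \<beta>2, \<gamma>).
     \<beta>1 > 0 \<and> \<beta>2 > 0 \<and> (\<forall>i\<in>{0..m}. \<gamma> i > 0) \<and>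
     \<beta>1 + \<beta>2 = (\<Sum>i=0..m. \<gamma> i) \<and>
     (k \<ge> 1 \<longrightarrow> \<beta>1 - (\<Sum>i=0..<k. \<gamma> i) > 0) \<and>
     \<beta>1 - (\<Sum>i=0..k. \<gamma> i) \<le> 0}"

definition multi_indices :: "nat \<Rightarrow> (nat \<Rightarrow> nat) set" where
  "multi_indices m = {1..m} \<rightarrow>\<^sub>E UNIV"

definition lauricella_FD ::
  "nat \<Rightarrow> complex \<Rightarrow> (nat \<Rightarrow> complex) \<Rightarrow> complex \<Rightarrow> (nat \<Rightarrow> complex) \<Rightarrow> complex" where
  "lauricella_FD m a b c x =
     (\<Sum>\<^sub>\<infinity>n\<in>multi_indices m.
        pochhammer a (\<Sum>l=1..m. n l) * (\<Prod>l=1..m. pochhammer (b l) (n l)) /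
        (pochhammer c (\<Sum>l=1..m. n l) * (\<Prod>l=1..m. fact (n l))) *
        (\<Prod>l=1..m. x l ^ n l))"

text \<open>The product of Gamma values in the denominator is inverted factor by factor with the
  entire function \<^const>\<open>rGamma\<close>, so that it vanishes at the poles of \<^const>\<open>Gamma\<close>.\<close>

definition recip_Gamma_k ::
  "nat \<Rightarrow> nat \<Rightarrow> complex \<Rightarrow> (nat \<Rightarrow> complex) \<Rightarrow> complex \<Rightarrow> (nat \<Rightarrow> nat) \<Rightarrow> complex" where
  "recip_Gamma_k m k a b c n =
     rGamma (c - a - of_nat (n k)) *
     (\<Prod>l\<in>{1..m} - {k}. rGamma (1 - b l - of_nat (n l))) *
     (\<Prod>l=1..m. rGamma (1 + of_nat (n l))) *
     rGamma (- (\<Sum>l=1..k. b l) + c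
       - (\<Sum>l=1..k. of_nat (n l)) + (\<Sum>l=k+1..m. of_nat (n l))) *
     rGamma (2 + (\<Sum>l=1..<k. b l) - c
       + (\<Sum>l=1..k. of_nat (n l)) - (\<Sum>l=k+1..m. of_nat (n l)))"

text \<open>The powers in front of the series are principal branches. For integral \<open>b\<close> and \<open>c\<close> and
  nonzero \<open>x\<close> they are the ordinary integer powers.\<close>

definition f_k ::
  "nat \<Rightarrow> nat \<Rightarrow> complex \<Rightarrow> (nat \<Rightarrow> complex) \<Rightarrow> complex \<Rightarrow> (nat \<Rightarrow> complex) \<Rightarrow> complex" where
  "f_k m k a b c x =
     (\<Prod>l=1..<k. x l powr (- b l)) * x k powr ((\<Sum>l=1..<k. b l) - c + 1) *
     (\<Sum>\<^sub>\<infinity>n\<in>multi_indices m.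
        recip_Gamma_k m k a b c n *
        (\<Prod>l=1..<k. (x k / x l) ^ n l) * x k ^ n k * (\<Prod>l=k+1..m. (x l / x k) ^ n l))"

definition partial_deriv ::
  "nat \<Rightarrow> ((nat \<Rightarrow> complex) \<Rightarrow> complex) \<Rightarrow> (nat \<Rightarrow> complex) \<Rightarrow> complex" where
  "partial_deriv i f x = deriv (\<lambda>t. f (x(i := t))) (x i)"

definition deriv_vec ::
  "nat \<Rightarrow> (nat \<Rightarrow> complex) \<Rightarrow> ((nat \<Rightarrow> complex) \<Rightarrow> complex) \<Rightarrow> (nat \<Rightarrow> complex) \<Rightarrow> complex Matrix.vec"
  where
  "deriv_vec m b f x =
     Matrix.vec (m + 1) (\<lambda>i. if i = 0 then f x else (x i - 1) / (- b i) * partial_deriv i f x)"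

definition F_vec ::
  "nat \<Rightarrow> complex \<Rightarrow> (nat \<Rightarrow> complex) \<Rightarrow> complex \<Rightarrow> (nat \<Rightarrow> complex) \<Rightarrow> complex Matrix.vec" where
  "F_vec m a b c x = deriv_vec m b (lauricella_FD m a b c) x"

definition F_k_vec ::
  "nat \<Rightarrow> nat \<Rightarrow> complex \<Rightarrow> (nat \<Rightarrow> complex) \<Rightarrow> complex \<Rightarrow> (nat \<Rightarrow> complex) \<Rightarrow> complex Matrix.vec"
  where
  "F_k_vec m k a b c x = deriv_vec m b (f_k m k a b c) x"

definition x_ext :: "nat \<Rightarrow> (nat \<Rightarrow> complex) \<Rightarrow> nat \<Rightarrow> complex" where
  "x_ext m x j = (if j = 0 then 0 else if j = m + 1 then 1 else x j)"

definition alpha :: "nat \<Rightarrow> complex \<Rightarrow> (nat \<Rightarrow> complex) \<Rightarrow> complex \<Rightarrow> nat \<Rightarrow> complex" where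
  "alpha m a b c j =
     (if j = 0 then - c + (\<Sum>l=1..m. b l)
      else if j \<le> m then - b j
      else if j = m + 1 then c - a
      else a)"

definition ones_mat :: "nat \<Rightarrow> complex mat" where
  "ones_mat m = Matrix.mat (m + 1) (m + 1) (\<lambda>_. 1)"

definition C_mat :: "nat \<Rightarrow> complex \<Rightarrow> (nat \<Rightarrow> complex) \<Rightarrow> complex \<Rightarrow> complex mat" where
  "C_mat m a b c =
     (let \<alpha> = alpha m a b c in
      (2 * of_real pi * \<i>) \<cdot>\<^sub>m
        ((1 / \<alpha> (m + 1)) \<cdot>\<^sub>m ones_mat m
         + mat_diag (m + 1) (\<lambda>i. if i = 0 then 1 / \<alpha> (m + 2) else 1 / \<alpha> i)))"

definition Q_mat ::
  "nat \<Rightarrow> nat \<Rightarrow> complex \<Rightarrow> (nat \<Rightarrow> complex) \<Rightarrow> complex \<Rightarrow> (nat \<Rightarrow> complex) \<Rightarrow> complex mat" where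
  "Q_mat m k a b c x =
     (let \<alpha> = alpha m a b c;
          X = x_ext m x;
          N = ones_mat m;
          D = mat_diag (m + 1) (\<lambda>i. if i = 0 then 0 else 1 - X i);
          E = mat_diag (m + 1) (\<lambda>i. if i = 0 then 1 else 0)
      in (2 * of_real pi * \<i>) \<cdot>\<^sub>m
        (((1 - X k) / \<alpha> (m + 1)) \<cdot>\<^sub>m N
         + (1 / \<alpha> (m + 2)) \<cdot>\<^sub>m (D * N * E)
         - (1 / (1 - \<alpha> (m + 2))) \<cdot>\<^sub>m (E * N * D)
         + mat_diag (m + 1) (\<lambda>i.
             if i = 0
             then (1 - X k) / \<alpha> (m + 2)
                  - 1 / (1 - \<alpha> (m + 2)) * ((\<Sum>p=1..m+1. \<alpha> p * X p) / \<alpha> (m + 2) + 1)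
             else (X i - X k) / \<alpha> i)))"

text \<open>\<^const>\<open>mat_inverse\<close> returns \<open>None\<close> on singular matrices, so \<open>P_mat\<close> is meaningful only where
  \<open>C_mat\<close> is invertible. When all the \<open>\<alpha>\<^sub>j\<close> involved are nonzero, this is the condition
  \<open>\<alpha>\<^sub>0 \<noteq> 0\<close>, since \<open>\<alpha>\<^sub>0 + \<dots> + \<alpha>\<^sub>m\<^sub>+\<^sub>2 = 0\<close>.\<close>

definition P_mat ::
  "nat \<Rightarrow> nat \<Rightarrow> complex \<Rightarrow> (nat \<Rightarrow> complex) \<Rightarrow> complex \<Rightarrow> (nat \<Rightarrow> complex) \<Rightarrow> complex mat" where
  "P_mat m k a b c x = Q_mat m k a b c x * the (mat_inverse (C_mat m a b c))"

end

theory Submission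
  imports Defs "Jordan_Normal_Form.Determinant"
begin

text \<open>
  \<open>C\<close> is a multiple of a rank one perturbation of an invertible diagonal matrix, so the
  Sherman--Morrison formula gives \<open>C\<^sup>-\<^sup>1\<close>. Multiplying out \<open>P\<^sub>k v\<close> for a vector
  \<open>v = (f, (x\<^sub>i - 1)/(- b\<^sub>i) \<partial>\<^sub>i f)\<close>, all terms containing the total \<open>\<alpha>\<close>-weighted sum of \<open>v\<close>
  cancel, and the two matrix relations become scalar contiguity relations. For
  \<open>f = F\<^sub>D(a, b, c)\<close> and \<open>f' = F\<^sub>D(a - 1, b, c)\<close> these are
  \<open>(c - a) \<partial>\<^sub>i f' = (a - 1) (b\<^sub>i f + x\<^sub>i \<partial>\<^sub>i f - \<partial>\<^sub>i f)\<close> together with the Euler relation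
  \<open>(a - 1) f = (a - 1 + \<Sum> x\<^sub>i \<partial>\<^sub>i) f'\<close>; for \<open>f = f\<^sup>(\<^sup>k\<^sup>)(a, b, c)\<close> and
  \<open>g = f\<^sup>(\<^sup>k\<^sup>)(a - 1, b, c - 1)\<close> they are \<open>\<partial>\<^sub>i g = - (b\<^sub>i + x\<^sub>i \<partial>\<^sub>i) f\<close> and
  \<open>(1 - a) g = (c - 1 + \<Sum> x\<^sub>i \<partial>\<^sub>i) f + \<Sum> x\<^sub>i \<partial>\<^sub>i g\<close>. At integral parameters the series are finite,
  and the relations follow by comparing coefficients, using only
  \<open>z / \<Gamma>(z + 1) = 1 / \<Gamma>(z)\<close>, which holds for all \<open>z\<close> including the poles of \<open>\<Gamma>\<close>.
\<close>

subsection \<open>The inverse of \<open>C\<close>\<close>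

unbundle no vec_syntax

text \<open>The matrix is \<open>t\<close> times the sum of a diagonal part with inverse
  \<open>d\<close> and a rank one part with all entries \<open>1 / s\<close>. The denominator of the
  correction is \<open>s\<close> plus the entry sum of the diagonal inverse.\<close>

lemma rank_one_update_inverse:
  fixes d :: "nat \<Rightarrow> 'a::field" and s t :: 'a
  assumes "s \<noteq> 0" "t \<noteq> 0" "s + (\<Sum>i<n. d i) \<noteq> 0" "\<And>i. i < n \<Longrightarrow> d i \<noteq> 0"
  shows "Matrix.mat n n (\<lambda>(i, j). t * (1 / s + (if i = j then 1 / d i else 0))) *
         Matrix.mat n n (\<lambda>(i, j). ((if i = j then d i else 0) - d i * d j / (s + (\<Sum>i<n. d i))) / t)
         = 1\<^sub>m n" (is "?A * ?B = _")
proof (rule eq_matI)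
  fix i j assume ij: "i < dim_row (1\<^sub>m n :: 'a mat)" "j < dim_col (1\<^sub>m n :: 'a mat)"
  define S where "S = (\<Sum>i<n. d i)"
  \<comment> \<open>\<open>r\<close> is the multiple of \<open>d\<close> subtracted in column
    \<open>j\<close>. It makes the column sum \<open>d j - S * r\<close> equal to
    \<open>s * r\<close>, so the all-ones part contributes \<open>r\<close>, which is exactly what
    the diagonal part loses.\<close>
  define r where "r = d j / (s + S)"
  define B where "B l = (if l = j then d l else 0) - d l * r" for l
  have di: "d i \<noteq> 0" using assms ij by simp
  have "(s + S) * r = d j" using assms(3) by (simp add: r_def S_def)
  then have r: "d j = s * r + S * r" by (simp add: distrib_right)
  have "(?A * ?B) $$ (i, j) = (\<Sum>l<n. (1 / s + (if i = l then 1 / d i else 0)) * B l)"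
    using ij assms(2) by (simp add: scalar_prod_def atLeast0LessThan B_def S_def r_def)
  also have "\<dots> = (\<Sum>l<n. B l) / s + (\<Sum>l<n. if i = l then B l / d i else 0)"
    unfolding sum_divide_distrib sum.distrib[symmetric]
    by (intro sum.cong) (auto simp: distrib_right)
  also have "(\<Sum>l<n. if i = l then B l / d i else 0) = B i / d i"
    using ij by (simp add: sum.delta')
  also have "(\<Sum>l<n. B l) = d j - S * r"
    using ij unfolding B_def sum_subtractf S_def sum_distrib_right by simp
  also have "(d j - S * r) / s = r"
    using assms(1) by (simp add: r)
  also have "r + B i / d i = 1\<^sub>m n $$ (i, j)"
    using ij di by (auto simp: B_def diff_divide_distrib)
  finally show "(?A * ?B) $$ (i, j) = 1\<^sub>m n $$ (i, j)" .
qed auto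

text \<open>Over a field a right inverse of a square matrix is also a left inverse. So
  \<open>A\<close> is a unit of the matrix ring, which excludes \<open>None\<close>, and any matrix
  returned must coincide with \<open>B\<close>.\<close>

lemma mat_inverse_eqI:
  fixes A :: "'a::field mat"
  assumes "A \<in> carrier_mat n n" "B \<in> carrier_mat n n" "A * B = 1\<^sub>m n"
  shows "mat_inverse A = Some B"
proof (cases "mat_inverse A")
  case None
  have "B * A = 1\<^sub>m n" using mat_mult_left_right_inverse[OF assms] .
  then have "A \<in> Units (ring_mat TYPE('a) n undefined)"
    using assms by (auto simp: Units_def ring_mat_def)
  then show ?thesis using mat_inverse(1)[OF assms(1) None, of undefined] by blast
next
  case (Some B')
  from mat_inverse(2)[OF assms(1) this] have "B' * A = 1\<^sub>m n" "B' \<in> carrier_mat n n" by auto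
  then have "B' = B" using assms using assoc_mult_mat[of B' n n A n B n] by simp
  then show ?thesis using Some by simp
qed

text \<open>The rank one correction in the inverse of \<open>C\<close> enters only through the
  scalar \<open>q = T / A\<close>, and \<open>q\<close> drops out of every row. What remains depends
  on \<open>k\<close> only through \<open>x_ext m x k\<close>.\<close>

lemma P_mat_mult_vec:
  fixes v :: "complex Matrix.vec"
  assumes "a \<noteq> 0" "a \<noteq> 1" "c \<noteq> a" "\<forall>j\<in>{1..m}. b j \<noteq> 0" "c \<noteq> (\<Sum>j=1..m. b j)"
    and v: "v \<in> carrier_vec (m + 1)"
  shows "P_mat m k a b c x *\<^sub>v v = Matrix.vec (m + 1) (\<lambda>i.
    if i = 0
    then (1 - x_ext m x k) * v $ 0
         - ((c - a - (\<Sum>j=1..m. b j * x j)) * v $ 0 + (\<Sum>j=1..m. x j * b j * v $ j)) / (1 - a)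
    else (1 - x i) * v $ 0 + (x i - x_ext m x k) * v $ i)"
proof -
  define t :: complex where "t = 2 * of_real pi * \<i>"
  \<comment> \<open>These are the reciprocals of the diagonal part of \<open>C\<close>, up to the
    factor \<open>t\<close>: \<alpha>_{m+2} in row 0 and \<alpha>_i in row \<open>i\<close>;
    \<open>s\<close> below is \<alpha>_{m+1}.\<close>
  define d where "d i = (if i = 0 then a else - b i)" for i
  define s where "s = c - a"
  define A where "A = s + (\<Sum>i<m+1. d i)"
  define M where "M = Matrix.mat (m+1) (m+1)
    (\<lambda>(i, j). ((if i = j then d i else 0) - d i * d j / A) / t)"
  define T where "T = (\<Sum>i<m+1. d i * v $ i)"
  define q where "q = T / A"
  define w where "w i = d i * (v $ i - q)" for i
  define X where "X = x_ext m x k"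
  have Aq: "A * q = T" if "A \<noteq> 0" using that by (simp add: q_def)
  have t: "t \<noteq> 0" by (simp add: t_def)
  have s: "s \<noteq> 0" using assms by (simp add: s_def)
  have split0: "(\<Sum>i<m+1. g i) = g 0 + (\<Sum>i=1..m. g i)" for g :: "nat \<Rightarrow> complex"
    by (simp only: Suc_eq_plus1[symmetric] lessThan_Suc_atMost atMost_atLeast0)
       (simp add: sum.atLeast_Suc_atMost)
  \<comment> \<open>\<open>A\<close> is the negative of \<alpha>_0, so its nonvanishing is the
    invertibility condition for \<open>C\<close>.\<close>
  have A_eq: "A = c - (\<Sum>j=1..m. b j)"
    unfolding A_def split0 by (simp add: s_def d_def sum_negf)
  have A: "A \<noteq> 0" using assms A_eq by simp
  have d: "d i \<noteq> 0" if "i < m + 1" for i using that assms by (auto simp: d_def)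
  have C: "C_mat m a b c
      = Matrix.mat (m+1) (m+1) (\<lambda>(i, j). t * (1 / s + (if i = j then 1 / d i else 0)))"
    by (rule eq_matI) (auto simp: C_mat_def Let_def ones_mat_def mat_diag_def alpha_def t_def s_def d_def)
  have "mat_inverse (C_mat m a b c) = Some M"
    unfolding C
    by (rule mat_inverse_eqI[of _ "m+1"])
       (use rank_one_update_inverse[of s t d "m+1"] s t A d in \<open>auto simp: M_def A_def\<close>)
  then have P: "P_mat m k a b c x = Q_mat m k a b c x * M"
    by (simp add: P_mat_def)
  \<comment> \<open>The entries of \<open>Q\<close> without the factor \<open>t\<close>. The
    diagonal matrix with entries 1 - x_i has a zero in the corner, so the two triple products fill
    only column 0 below the corner and row 0 to the right of it.\<close>
  define E where "E i j =
      (1 - X) / s + (if j = 0 \<and> i \<noteq> 0 then (1 - x i) / a else 0)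
      - (if i = 0 \<and> j \<noteq> 0 then (1 - x j) / (1 - a) else 0)
      + (if i = j then if i = 0 then (1 - X) / a
            - 1 / (1 - a) * (((\<Sum>p=1..m. d p * x p) + s) / a + 1)
          else (x i - X) / d i else 0)" for i j
  have Q: "Q_mat m k a b c x = Matrix.mat (m+1) (m+1) (\<lambda>(i, j). t * E i j)"
  proof -
    have "(\<Sum>p=1..m+1. alpha m a b c p * x_ext m x p) = (\<Sum>p=1..m. d p * x p) + s"
    proof -
      have "(\<Sum>p=1..m. alpha m a b c p * x_ext m x p) = (\<Sum>p=1..m. d p * x p)"
        by (rule sum.cong) (auto simp: alpha_def x_ext_def d_def)
      then show ?thesis by (simp add: alpha_def x_ext_def s_def)
    qed
    then show ?thesis
      unfolding Q_mat_def Let_def ones_mat_def mat_diag_mult_left[OF mat_carrier]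
      apply (subst mat_diag_mult_right[OF mat_carrier])+
      apply (rule eq_matI)
      subgoal for i j
        by (cases "i = 0"; cases "j = 0"; cases "i = j")
           (simp_all add: mat_diag_def alpha_def t_def[symmetric] s_def d_def x_ext_def X_def E_def)
      apply (simp_all add: mat_diag_def)
      done
  qed
  have M: "M *\<^sub>v v = Matrix.vec (m+1) (\<lambda>i. w i / t)"
  proof (rule eq_vecI)
    fix i assume "i < dim_vec (Matrix.vec (m+1) (\<lambda>i. w i / t))"
    then have i: "i < m + 1" by simp
    have "(M *\<^sub>v v) $ i
        = (\<Sum>j<m+1. ((if i = j then d i else 0) - d i * d j / A) / t * v $ j)"
      using i v by (simp add: M_def scalar_prod_def atLeast0LessThan)
    also have "\<dots> = (\<Sum>j<m+1. (if i = j then d i * v $ i / t else 0) - d i / A / t * (d j * v $ j))"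
      using A t by (intro sum.cong) (auto simp: field_simps)
    also have "\<dots> = d i * v $ i / t - d i / A / t * T"
      using i unfolding sum_subtractf T_def sum_distrib_left[symmetric] by (simp add: sum.delta')
    also have "\<dots> = w i / t" by (simp add: w_def q_def algebra_simps diff_divide_distrib)
    finally show "(M *\<^sub>v v) $ i = Matrix.vec (m+1) (\<lambda>i. w i / t) $ i" using i by simp
  qed (simp add: M_def)
  \<comment> \<open>Since \<open>A\<close> exceeds the sum of the \<open>d i\<close> by
    \<open>s\<close>, subtracting \<open>q\<close> from every entry of \<open>v\<close> leaves the
    weighted sum \<open>T - (A - s) * q\<close>. The all-ones part of \<open>Q\<close>, with factor
    \<open>(1 - X) / s\<close>, turns this into \<open>(1 - X) * q\<close>.\<close>
  have w_sum: "(\<Sum>i<m+1. w i) = s * q"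
  proof -
    have "(\<Sum>i<m+1. w i) = T - (\<Sum>i<m+1. d i) * q"
      by (simp only: w_def right_diff_distrib sum_subtractf sum_distrib_right T_def[symmetric])
    also have "\<dots> = s * q" using Aq[OF A] by (simp add: A_def algebra_simps)
    finally show ?thesis .
  qed
  have T_eq: "T = a * v $ 0 + (\<Sum>j=1..m. d j * v $ j)"
    unfolding T_def split0 by (simp add: d_def)
  have "P_mat m k a b c x *\<^sub>v v = Q_mat m k a b c x *\<^sub>v (M *\<^sub>v v)"
    unfolding P using v by (intro assoc_mult_mat_vec[of _ "m+1" "m+1" _ "m+1"]) (auto simp: Q M_def)
  also have "\<dots> = Matrix.vec (m + 1) (\<lambda>i.
    if i = 0
    then (1 - X) * v $ 0
         - ((c - a - (\<Sum>j=1..m. b j * x j)) * v $ 0 + (\<Sum>j=1..m. x j * b j * v $ j)) / (1 - a)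
    else (1 - x i) * v $ 0 + (x i - X) * v $ i)" (is "_ = Matrix.vec _ ?r")
  proof (rule eq_vecI)
    fix i assume "i < dim_vec (Matrix.vec (m + 1) ?r)"
    then have i: "i < m + 1" by simp
    have wi: "w j / d j = v $ j - q" if "j < m + 1" for j
      using d[OF that] by (simp add: w_def)
    have "(Q_mat m k a b c x *\<^sub>v (M *\<^sub>v v)) $ i
        = (\<Sum>j<m+1. E i j * w j)"
      using i t by (simp add: M Q scalar_prod_def atLeast0LessThan)
    also have "\<dots> = ?r i"
    proof (cases "i = 0")
      case False
      have "(\<Sum>j<m+1. E i j * w j)
          = (\<Sum>j<m+1. (1 - X) / s * w j + (if 0 = j then (1 - x i) / a * w 0 else 0)
               + (if i = j then (x i - X) / d i * w i else 0))"
        using False by (intro sum.cong) (auto simp: E_def distrib_right)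
      also have "\<dots> = (1 - X) / s * (\<Sum>j<m+1. w j) + (1 - x i) * (w 0 / d 0) + (x i - X) * (w i / d i)"
        using i False unfolding sum.distrib sum_distrib_left[symmetric]
        by (simp add: sum.delta' d_def)
      \<comment> \<open>The coefficients of \<open>q\<close>, namely \<open>1 - X\<close>,
        \<open>-(1 - x i)\<close> and \<open>-(x i - X)\<close>, add up to zero.\<close>
      also have "\<dots> = (1 - X) * q + (1 - x i) * (v $ 0 - q) + (x i - X) * (v $ i - q)"
        using i s by (simp only: w_sum wi) (simp add: wi)
      also have "\<dots> = ?r i" using False by (simp add: algebra_simps)
      finally show ?thesis .
    next
      case True
      \<comment> \<open>This is the sum of \<alpha>_p x_p over p = 1, ..., m+1 in the corner entry
        of \<open>Q\<close>; its last term is \<open>s\<close> because x_{m+1} = 1.\<close>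
      define Y where "Y = (\<Sum>p=1..m. d p * x p) + s"
      have diag: "((1 - X) / a - 1 / (1 - a) * (Y / a + 1)) * w 0
          = ((1 - X) - 1 / (1 - a) * (Y + a)) * (w 0 / d 0)"
      proof -
        have "Y / a + 1 = (Y + a) / a" using assms(1) by (simp add: add_divide_distrib)
        then show ?thesis unfolding d_def divide_inverse by (simp add: algebra_simps)
      qed
      have "(\<Sum>j<m+1. E i j * w j)
          = (\<Sum>j<m+1. (1 - X) / s * w j - (if j = 0 then 0 else (1 - x j) / (1 - a) * w j)
               + (if 0 = j then ((1 - X) / a - 1 / (1 - a) * (Y / a + 1)) * w 0 else 0))"
        using True by (intro sum.cong) (auto simp: E_def Y_def ring_distribs)
      also have "\<dots> = (1 - X) / s * (\<Sum>j<m+1. w j)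
           - (\<Sum>j<m+1. if j = 0 then 0 else (1 - x j) / (1 - a) * w j)
           + ((1 - X) - 1 / (1 - a) * (Y + a)) * (w 0 / d 0)"
        unfolding sum.distrib sum_subtractf sum_distrib_left[symmetric] diag
        by (simp add: sum.delta')
      also have "(\<Sum>j<m+1. if j = 0 then 0 else (1 - x j) / (1 - a) * w j)
          = (\<Sum>j=1..m. (1 - x j) / (1 - a) * w j)"
        unfolding split0 by simp
      also have "\<dots> = (\<Sum>j=1..m. (1 - x j) * w j) / (1 - a)"
        by (simp add: sum_divide_distrib)
      also have "(\<Sum>j=1..m. (1 - x j) * w j) = (\<Sum>j=1..m. d j * v $ j) - (\<Sum>j=1..m. x j * d j * v $ j)
           - ((\<Sum>j=1..m. d j) - (\<Sum>j=1..m. d j * x j)) * q"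
        unfolding sum_subtractf[symmetric] sum_distrib_right w_def
        by (intro sum.cong) (auto simp: algebra_simps)
      also have "(\<Sum>j=1..m. d j) = A - s - a"
        unfolding A_def split0 by (simp add: d_def)
      also have "(\<Sum>j=1..m. d j * v $ j) = T - a * v $ 0" by (simp add: T_eq)
      also have "(\<Sum>j=1..m. d j * x j) = Y - s" by (simp add: Y_def)
      also have "(1 - X) / s * (\<Sum>j<m+1. w j) = (1 - X) * q" unfolding w_sum using s by simp
      also have "w 0 / d 0 = v $ 0 - q" by (simp add: wi)
      finally have "(\<Sum>j<m+1. E i j * w j) =
        (1 - X) * q - (T - a * v $ 0 - (\<Sum>j=1..m. x j * d j * v $ j)
          - (A - s - a - (Y - s)) * q) / (1 - a)
        + ((1 - X) - 1 / (1 - a) * (Y + a)) * (v $ 0 - q)" .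
      \<comment> \<open>In row 0 the terms with \<open>q\<close> and \<open>T\<close> collect into
        \<open>T - A * q\<close>, which is zero by the choice of \<open>q\<close>.\<close>
      also have "\<dots> = (1 - X) * v $ 0 - (T - A * q - (\<Sum>j=1..m. x j * d j * v $ j) + Y * v $ 0) / (1 - a)"
        unfolding divide_inverse by (simp add: algebra_simps)
      also have "(\<Sum>j=1..m. x j * d j * v $ j) = - (\<Sum>j=1..m. x j * b j * v $ j)"
        unfolding sum_negf[symmetric] by (intro sum.cong) (auto simp: d_def)
      also have "Y = c - a - (\<Sum>j=1..m. b j * x j)"
      proof -
        have "(\<Sum>p=1..m. d p * x p) = - (\<Sum>j=1..m. b j * x j)"
          unfolding sum_negf[symmetric] by (intro sum.cong) (auto simp: d_def)
        then show ?thesis by (simp add: Y_def s_def)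
      qed
      finally show ?thesis using True Aq[OF A] by (simp add: algebra_simps)
    qed
    finally show "(Q_mat m k a b c x *\<^sub>v (M *\<^sub>v v)) $ i = Matrix.vec (m + 1) ?r $ i"
      using i by simp
  qed (simp add: Q)
  finally show ?thesis unfolding X_def .
qed

subsection \<open>Finite Laurent sums\<close>

lemma sum_fun_upd_Suc:
  assumes "finite A"
  shows "(\<Sum>l\<in>A. of_nat ((n(i := Suc (n i))) l) :: 'a::semiring_1)
       = (\<Sum>l\<in>A. of_nat (n l)) + (if i \<in> A then 1 else 0)"
proof -
  have "(\<Sum>l\<in>A. of_nat ((n(i := Suc (n i))) l) :: 'a)
      = (\<Sum>l\<in>A. of_nat (n l) + (if i = l then 1 else 0))"
    by (intro sum.cong) (auto simp: add.commute)
  then show ?thesis using assms by (simp add: sum.distrib sum.delta')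
qed

lemma prod_fun_upd:
  assumes "finite A" "i \<in> A"
  shows "(\<Prod>l\<in>A. g l ((n(i := y)) l)) = g i y * (\<Prod>l\<in>A - {i}. g l (n l))"
  using assms by (subst prod.remove[of A i]) (auto intro!: arg_cong2[of _ _ _ _ "(*)"] prod.cong)

text \<open>The weight \<open>n i\<close> vanishes on the face \<open>n i = 0\<close> of the box, so the shift produces no boundary term.\<close>

lemma sum_box_shift:
  fixes H :: "(nat \<Rightarrow> nat) \<Rightarrow> 'a::semiring_1"
  assumes "finite A" "i \<in> A" and H: "\<And>n. n i = K \<Longrightarrow> H n = 0"
  shows "(\<Sum>n\<in>A \<rightarrow>\<^sub>E {..<K}. of_nat (n i) * H n)
       = (\<Sum>n\<in>A \<rightarrow>\<^sub>E {..<K}. of_nat (Suc (n i)) * H (n(i := Suc (n i))))"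
proof -
  let ?S = "A \<rightarrow>\<^sub>E {..<K}"
  have fin: "finite ?S" using assms by (simp add: finite_PiE)
  have "(\<Sum>n\<in>?S. of_nat (n i) * H n) = (\<Sum>n\<in>{n \<in> ?S. n i \<noteq> 0}. of_nat (n i) * H n)"
    using fin by (intro sum.mono_neutral_right) auto
  also have "\<dots> = (\<Sum>n\<in>{n \<in> ?S. Suc (n i) \<noteq> K}. of_nat (Suc (n i)) * H (n(i := Suc (n i))))"
  proof (rule sum.reindex_bij_witness[of _ "\<lambda>n. n(i := Suc (n i))" "\<lambda>n. n(i := n i - 1)"])
    fix n assume "n \<in> {n \<in> ?S. n i \<noteq> 0}"
    then have *: "\<And>l. l \<in> A \<Longrightarrow> n l < K" "\<And>l. l \<notin> A \<Longrightarrow> n l = undefined" "n i \<noteq> 0"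
      by (auto simp: PiE_def extensional_def Pi_def)
    show "(n(i := n i - 1))(i := Suc ((n(i := n i - 1)) i)) = n"
      using * by (auto simp: fun_eq_iff)
    show "n(i := n i - 1) \<in> {n \<in> ?S. Suc (n i) \<noteq> K}"
      using * \<open>i \<in> A\<close> by (auto simp: PiE_def extensional_def Pi_def less_imp_diff_less)
    show "of_nat (Suc ((n(i := n i - 1)) i)) * H ((n(i := n i - 1))(i := Suc ((n(i := n i - 1)) i)))
        = of_nat (n i) * H n"
      using * by (simp add: fun_upd_idem)
  next
    fix n assume "n \<in> {n \<in> ?S. Suc (n i) \<noteq> K}"
    then have *: "\<And>l. l \<in> A \<Longrightarrow> n l < K" "\<And>l. l \<notin> A \<Longrightarrow> n l = undefined" "Suc (n i) \<noteq> K"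
      by (auto simp: PiE_def extensional_def Pi_def)
    show "(n(i := Suc (n i)))(i := (n(i := Suc (n i))) i - 1) = n" by (auto simp: fun_eq_iff)
    have "Suc (n i) < K" using *(1)[OF \<open>i \<in> A\<close>] *(3) by simp
    with * \<open>i \<in> A\<close> show "n(i := Suc (n i)) \<in> {n \<in> ?S. n i \<noteq> 0}"
      by (auto simp: PiE_def extensional_def Pi_def)
  qed
  \<comment> \<open>The omitted face \<open>Suc (n i) = K\<close> can be added back because
    \<open>H\<close> vanishes at height \<open>K\<close>.\<close>
  also have "\<dots> = (\<Sum>n\<in>?S. of_nat (Suc (n i)) * H (n(i := Suc (n i))))"
    using fin H by (intro sum.mono_neutral_left) auto
  finally show ?thesis .
qed

text \<open>All terms outside the box vanish, so the infinite sum becomes a finite one without any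
  summability argument.\<close>

lemma infsum_multi_indices:
  fixes g :: "(nat \<Rightarrow> nat) \<Rightarrow> complex"
  assumes "\<And>n l. l \<in> {1..m} \<Longrightarrow> n l \<ge> K \<Longrightarrow> g n = 0"
  shows "(\<Sum>\<^sub>\<infinity>n\<in>multi_indices m. g n) = (\<Sum>n\<in>{1..m} \<rightarrow>\<^sub>E {..<K}. g n)"
proof -
  have "(\<Sum>\<^sub>\<infinity>n\<in>multi_indices m. g n) = (\<Sum>\<^sub>\<infinity>n\<in>{1..m} \<rightarrow>\<^sub>E {..<K}. g n)"
  proof (rule infsum_cong_neutral)
    fix n assume "n \<in> multi_indices m - ({1..m} \<rightarrow>\<^sub>E {..<K})"
    then obtain l where "l \<in> {1..m}" "n l \<ge> K"
      by (force simp: multi_indices_def PiE_def Pi_def)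
    then show "g n = 0" by (rule assms)
  qed (auto simp: multi_indices_def)
  then show ?thesis by (simp add: finite_PiE)
qed

text \<open>The Laurent form is required only near the point, since for \<open>f_k\<close> it is
  available only where the variables are nonzero. The alternative in the last hypothesis admits
  \<open>x i = 0\<close> for polynomials.\<close>

lemma partial_deriv_Laurent:
  fixes x :: "nat \<Rightarrow> complex" and e :: "'n \<Rightarrow> nat \<Rightarrow> int"
  assumes "finite S" and i: "i \<in> {1..m}"
    and ev: "eventually (\<lambda>t. f (x(i := t)) = (\<Sum>n\<in>S. G n * (\<Prod>l=1..m. (x(i := t)) l powi e n l))) (nhds (x i))"
    and nz: "x i \<noteq> 0 \<or> (\<forall>n\<in>S. e n i \<ge> 0)"
  shows "partial_deriv i f x = (\<Sum>n\<in>S. of_int (e n i) *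
           (G n * (x i powi (e n i - 1) * (\<Prod>l\<in>{1..m} - {i}. x l powi e n l))))"
proof -
  have split: "(\<Prod>l=1..m. (x(i := t)) l powi e n l)
      = t powi e n i * (\<Prod>l\<in>{1..m} - {i}. x l powi e n l)" for t n
    using prod_fun_upd[OF _ i, of "\<lambda>l y. y powi e n l" x t] by simp
  have "((\<lambda>t. \<Sum>n\<in>S. G n * (t powi e n i * (\<Prod>l\<in>{1..m} - {i}. x l powi e n l)))
      has_field_derivative (\<Sum>n\<in>S. of_int (e n i) *
           (G n * (x i powi (e n i - 1) * (\<Prod>l\<in>{1..m} - {i}. x l powi e n l))))) (at (x i))"
    using nz by (auto intro!: derivative_eq_intros sum.cong)
  then show ?thesis
    unfolding partial_deriv_def deriv_cong_ev[OF ev refl] split by (rule DERIV_imp_deriv)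
qed

text \<open>The Euler operator is diagonal on monomials, so both sides of a relation can be compared
  without shifting indices.\<close>

lemma partial_deriv_Laurent':
  fixes x :: "nat \<Rightarrow> complex" and e :: "'n \<Rightarrow> nat \<Rightarrow> int"
  assumes "finite S" and i: "i \<in> {1..m}"
    and "eventually (\<lambda>t. f (x(i := t)) = (\<Sum>n\<in>S. G n * (\<Prod>l=1..m. (x(i := t)) l powi e n l))) (nhds (x i))"
    and nz: "x i \<noteq> 0 \<or> (\<forall>n\<in>S. e n i \<ge> 0)"
  shows "x i * partial_deriv i f x
       = (\<Sum>n\<in>S. of_int (e n i) * (G n * (\<Prod>l=1..m. x l powi e n l)))"
proof -
  have "x i * (of_int (e n i) * (G n * (x i powi (e n i - 1) * (\<Prod>l\<in>{1..m} - {i}. x l powi e n l))))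
      = of_int (e n i) * (G n * (\<Prod>l=1..m. x l powi e n l))" if "n \<in> S" for n
  proof -
    \<comment> \<open>The weight \<open>e n i\<close> is kept on both sides because at
      \<open>x i = 0\<close> and exponent 0 the powers alone would disagree.\<close>
    have 1: "of_int (e n i) * (x i * x i powi (e n i - 1)) = of_int (e n i) * x i powi e n i"
      using nz that by (cases "x i = 0"; cases "e n i = 0") (auto simp: power_int_minus_left power_int_diff power_int_0_left_if)
    have 2: "(\<Prod>l=1..m. x l powi e n l) = x i powi e n i * (\<Prod>l\<in>{1..m} - {i}. x l powi e n l)"
      using i by (subst prod.remove[of _ i]) auto
    have "x i * (of_int (e n i) * (G n * (x i powi (e n i - 1) * (\<Prod>l\<in>{1..m} - {i}. x l powi e n l))))
        = (of_int (e n i) * (x i * x i powi (e n i - 1))) * (G n * (\<Prod>l\<in>{1..m} - {i}. x l powi e n l))"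
      by (simp only: mult_ac)
    also have "\<dots> = of_int (e n i) * (G n * (\<Prod>l=1..m. x l powi e n l))"
      unfolding 1 2 by (simp only: mult_ac)
    finally show ?thesis .
  qed
  then show ?thesis
    unfolding partial_deriv_Laurent[OF assms] sum_distrib_left by (rule sum.cong[OF refl])
qed

subsection \<open>Contiguity of terminating Lauricella series\<close>

definition FD_coeff :: "nat \<Rightarrow> complex \<Rightarrow> (nat \<Rightarrow> complex) \<Rightarrow> complex \<Rightarrow> (nat \<Rightarrow> nat) \<Rightarrow> complex" where
  "FD_coeff m a b c n = pochhammer a (\<Sum>l=1..m. n l) * (\<Prod>l=1..m. pochhammer (b l) (n l)) /
     (pochhammer c (\<Sum>l=1..m. n l) * (\<Prod>l=1..m. fact (n l)))"

lemma FD_coeff_eq_0: "l \<in> {1..m} \<Longrightarrow> pochhammer (b l) (n l) = 0 \<Longrightarrow> FD_coeff m a b c n = 0"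
  by (auto simp: FD_coeff_def)

text \<open>Raising \<open>n i\<close> by one extends the Pochhammer symbols of \<open>a\<close>,
  \<open>b i\<close> and \<open>c\<close> and the factorial by one factor each. The hypothesis on
  \<open>c\<close> keeps the denominators nonzero.\<close>

lemma FD_coeff_Suc:
  assumes c: "\<And>n. c + of_nat n \<noteq> 0" and i: "i \<in> {1..m}"
  shows "(c + of_nat (\<Sum>l=1..m. n l)) * (of_nat (Suc (n i)) * FD_coeff m a b c (n(i := Suc (n i))))
       = (a + of_nat (\<Sum>l=1..m. n l)) * (b i + of_nat (n i)) * FD_coeff m a b c n"
proof -
  define N where "N = (\<Sum>l=1..m. n l)"
  have N: "(\<Sum>l=1..m. (n(i := Suc (n i))) l) = Suc N"
    using sum_fun_upd_Suc[of "{1..m}" n i, where 'a=nat] i by (simp add: N_def)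
  have pb: "(\<Prod>l=1..m. pochhammer (b l) (n l)) = pochhammer (b i) (n i) * (\<Prod>l\<in>{1..m} - {i}. pochhammer (b l) (n l))"
    using i by (subst prod.remove[of _ i]) auto
  have pf: "(\<Prod>l=1..m. fact (n l) :: complex) = fact (n i) * (\<Prod>l\<in>{1..m} - {i}. fact (n l))"
    using i by (subst prod.remove[of _ i]) auto
  have pb': "(\<Prod>l=1..m. pochhammer (b l) ((n(i := Suc (n i))) l))
      = pochhammer (b i) (Suc (n i)) * (\<Prod>l\<in>{1..m} - {i}. pochhammer (b l) (n l))"
    using i by (intro prod_fun_upd) auto
  have pf': "(\<Prod>l=1..m. fact ((n(i := Suc (n i))) l) :: complex)
      = fact (Suc (n i)) * (\<Prod>l\<in>{1..m} - {i}. fact (n l))"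
    using i by (intro prod_fun_upd) auto
  have "pochhammer c N \<noteq> 0"
    using c by (metis pochhammer_eq_0_iff add.commute add.left_inverse)
  moreover have "(\<Prod>l\<in>{1..m} - {i}. fact (n l) :: complex) \<noteq> 0" by simp
  moreover have "(1 + of_nat (n i) :: complex) \<noteq> 0"
    by (metis of_nat_Suc of_nat_eq_0_iff nat.distinct(1))
  ultimately show ?thesis
    using c[of N]
    unfolding FD_coeff_def N N_def[symmetric] pb pf pb' pf'
    by (simp add: pochhammer_Suc divide_simps)
qed

text \<open>The symbol (a-1, N+1) can be split off at its last factor or at its first.\<close>

lemma FD_coeff_shift:
  assumes c: "\<And>n. c + of_nat n \<noteq> 0"
  shows "(a - 1 + of_nat (\<Sum>l=1..m. n l)) * FD_coeff m (a - 1) b c n = (a - 1) * FD_coeff m a b c n"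
proof -
  have "(a - 1 + of_nat N) * pochhammer (a - 1) N = (a - 1) * pochhammer a N" for N
    by (metis pochhammer_rec pochhammer_Suc mult.commute diff_add_cancel)
  from this[of "\<Sum>l=1..m. n l"] show ?thesis by (simp add: FD_coeff_def del: of_nat_sum)
qed

text \<open>Once some \<open>n l\<close> reaches \<open>K\<close>, the factor (b_l, n_l) contains
  (b_l, K) = 0. The exponents are written with \<open>powi\<close> to fit the Laurent
  lemmas.\<close>

lemma lauricella_FD_eq:
  assumes "\<forall>l\<in>{1..m}. pochhammer (b l) K = 0"
  shows "lauricella_FD m a b c x
       = (\<Sum>n\<in>{1..m} \<rightarrow>\<^sub>E {..<K}. FD_coeff m a b c n * (\<Prod>l=1..m. x l powi int (n l)))"
proof -
  have "FD_coeff m a b c n = 0" if "l \<in> {1..m}" "n l \<ge> K" for n l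
    using that assms pochhammer_eq_0_mono by (intro FD_coeff_eq_0[of l]) blast+
  then show ?thesis
    unfolding lauricella_FD_def FD_coeff_def[symmetric] power_int_of_nat
    by (intro infsum_multi_indices) auto
qed

text \<open>The plain derivative is reindexed so that it is expanded in the same monomials as the
  series itself; the coefficient at \<open>n i = K\<close> vanishes, so the box stays the
  same.\<close>

lemma partial_deriv_FD:
  assumes b: "\<forall>l\<in>{1..m}. pochhammer (b l) K = 0" and i: "i \<in> {1..m}"
  shows "partial_deriv i (lauricella_FD m a b c) x = (\<Sum>n\<in>{1..m} \<rightarrow>\<^sub>E {..<K}.
           of_nat (Suc (n i)) * FD_coeff m a b c (n(i := Suc (n i))) * (\<Prod>l=1..m. x l powi int (n l)))" (is ?A)
    and "x i * partial_deriv i (lauricella_FD m a b c) x = (\<Sum>n\<in>{1..m} \<rightarrow>\<^sub>E {..<K}.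
           of_nat (n i) * FD_coeff m a b c n * (\<Prod>l=1..m. x l powi int (n l)))" (is ?B)
proof -
  let ?S = "{1..m} \<rightarrow>\<^sub>E {..<K}"
  define H where "H n = FD_coeff m a b c n *
    (x i powi (int (n i) - 1) * (\<Prod>l\<in>{1..m} - {i}. x l powi int (n l)))" for n
  have fin: "finite ?S" by (simp add: finite_PiE)
  have "partial_deriv i (lauricella_FD m a b c) x = (\<Sum>n\<in>?S. of_nat (n i) * H n)"
    unfolding H_def
    by (subst partial_deriv_Laurent[OF fin i always_eventually, where e = "\<lambda>n l. int (n l)"])
       (simp_all only: lauricella_FD_eq[OF b] of_int_of_nat_eq of_nat_0_le_iff simp_thms Ball_def)
  also have "\<dots> = (\<Sum>n\<in>?S. of_nat (Suc (n i)) * H (n(i := Suc (n i))))"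
    using i b by (intro sum_box_shift) (auto simp: H_def FD_coeff_eq_0)
  also have "\<dots> = (\<Sum>n\<in>?S. of_nat (Suc (n i)) * FD_coeff m a b c (n(i := Suc (n i))) * (\<Prod>l=1..m. x l powi int (n l)))"
  proof (rule sum.cong[OF refl])
    fix n
    have "(\<Prod>l\<in>{1..m} - {i}. x l powi int ((n(i := Suc (n i))) l)) = (\<Prod>l\<in>{1..m} - {i}. x l powi int (n l))"
      by (intro prod.cong) auto
    moreover have "(\<Prod>l=1..m. x l powi int (n l)) = x i powi int (n i) * (\<Prod>l\<in>{1..m} - {i}. x l powi int (n l))"
      using i by (subst prod.remove[of _ i]) auto
    ultimately show "of_nat (Suc (n i)) * H (n(i := Suc (n i)))
        = of_nat (Suc (n i)) * FD_coeff m a b c (n(i := Suc (n i))) * (\<Prod>l=1..m. x l powi int (n l))"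
      unfolding H_def by simp
  qed
  finally show ?A .
  show ?B
    by (subst partial_deriv_Laurent'[OF fin i always_eventually, where e = "\<lambda>n l. int (n l)"])
       (simp_all only: lauricella_FD_eq[OF b] of_int_of_nat_eq of_nat_0_le_iff simp_thms Ball_def mult.assoc)
qed

text \<open>All series are expanded over one box in the same monomials, so the relation is checked
  coefficient by coefficient.\<close>

lemma FD_contiguity_deriv:
  assumes b: "\<forall>l\<in>{1..m}. pochhammer (b l) K = 0" and c: "\<And>n. c + of_nat n \<noteq> 0"
    and i: "i \<in> {1..m}"
  shows "(c - a) * partial_deriv i (lauricella_FD m (a - 1) b c) x
       = (a - 1) * (b i * lauricella_FD m a b c x
           + x i * partial_deriv i (lauricella_FD m a b c) x - partial_deriv i (lauricella_FD m a b c) x)"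
  \<comment> \<open>The Euler form has to be rewritten first, before the bare derivative inside it
    is expanded.\<close>
  unfolding partial_deriv_FD(2)[OF b i]
  unfolding partial_deriv_FD(1)[OF b i] lauricella_FD_eq[OF b] sum_distrib_left
    sum.distrib[symmetric] sum_subtractf[symmetric]
proof (rule sum.cong[OF refl])
  fix n :: "nat \<Rightarrow> nat"
  let ?M = "\<Prod>l=1..m. x l powi int (n l)"
  define N :: complex where "N = of_nat (\<Sum>l=1..m. n l)"
  define A where "A = FD_coeff m a b c n"
  define A' where "A' = FD_coeff m (a - 1) b c n"
  define A1 where "A1 = of_nat (Suc (n i)) * FD_coeff m a b c (n(i := Suc (n i)))"
  define A1' where "A1' = of_nat (Suc (n i)) * FD_coeff m (a - 1) b c (n(i := Suc (n i)))"
  have 1: "(c + N) * A1 = (a + N) * (b i + of_nat (n i)) * A"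
    and 2: "(c + N) * A1' = (a - 1 + N) * (b i + of_nat (n i)) * A'"
    unfolding A_def A'_def A1_def A1'_def N_def by (rule FD_coeff_Suc[OF c i])+
  have 3: "(a - 1 + N) * A' = (a - 1) * A"
    unfolding A_def A'_def N_def by (rule FD_coeff_shift[OF c])
  have "c + N \<noteq> 0" using c by (simp add: N_def del: of_nat_sum)
  \<comment> \<open>After clearing \<open>c + N\<close>, the identity comes down to
    \<open>(c + N) - (a + N) = c - a\<close>.\<close>
  moreover have "(c + N) * ((c - a) * A1') = (c + N) * ((a - 1) * (b i * A + of_nat (n i) * A - A1))"
  proof -
    have "(c + N) * ((c - a) * A1') = (c - a) * (b i + of_nat (n i)) * ((a - 1 + N) * A')"
      using 2 by (simp only: mult.assoc mult.left_commute)
    also have "\<dots> = (a - 1) * ((c + N) * (b i * A + of_nat (n i) * A) - (a + N) * (b i + of_nat (n i)) * A)"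
      unfolding 3 by (simp add: algebra_simps)
    also have "\<dots> = (c + N) * ((a - 1) * (b i * A + of_nat (n i) * A - A1))"
      unfolding 1[symmetric] by (simp add: algebra_simps)
    finally show ?thesis .
  qed
  ultimately have "(c - a) * A1' = (a - 1) * (b i * A + of_nat (n i) * A - A1)" by simp
  then have "(c - a) * A1' * ?M = (a - 1) * (b i * A + of_nat (n i) * A - A1) * ?M" by simp
  then show "(c - a) * (of_nat (Suc (n i)) * FD_coeff m (a - 1) b c (n(i := Suc (n i))) * ?M)
      = (a - 1) * (b i * (FD_coeff m a b c n * ?M) + of_nat (n i) * FD_coeff m a b c n * ?M
          - of_nat (Suc (n i)) * FD_coeff m a b c (n(i := Suc (n i))) * ?M)"
    unfolding A_def A'_def A1_def A1'_def by (simp only: algebra_simps)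
qed

text \<open>The sum of the Euler operators multiplies each monomial by its total degree, the number
  appearing in \<open>FD_coeff_shift\<close>.\<close>

lemma FD_shift_eq_euler:
  assumes b: "\<forall>l\<in>{1..m}. pochhammer (b l) K = 0" and c: "\<And>n. c + of_nat n \<noteq> 0"
  shows "(a - 1) * lauricella_FD m a b c x = (a - 1) * lauricella_FD m (a - 1) b c x
           + (\<Sum>i=1..m. x i * partial_deriv i (lauricella_FD m (a - 1) b c) x)"
proof -
  let ?S = "{1..m} \<rightarrow>\<^sub>E {..<K}"
  let ?T = "\<lambda>n. FD_coeff m (a - 1) b c n * (\<Prod>l=1..m. x l powi int (n l))"
  have "(\<Sum>i=1..m. x i * partial_deriv i (lauricella_FD m (a - 1) b c) x)
      = (\<Sum>i=1..m. \<Sum>n\<in>?S. of_nat (n i) * ?T n)"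
    using partial_deriv_FD(2)[OF b] by (intro sum.cong) (auto simp: mult.assoc)
  also have "\<dots> = (\<Sum>n\<in>?S. of_nat (\<Sum>i=1..m. n i) * ?T n)"
    by (subst sum.swap) (simp add: sum_distrib_right)
  finally have eq: "(\<Sum>i=1..m. x i * partial_deriv i (lauricella_FD m (a - 1) b c) x) = \<dots>" .
  show ?thesis
    unfolding eq lauricella_FD_eq[OF b] sum_distrib_left sum.distrib[symmetric]
  proof (rule sum.cong[OF refl])
    fix n
    show "(a - 1) * (FD_coeff m a b c n * (\<Prod>l=1..m. x l powi int (n l)))
        = (a - 1) * ?T n + of_nat (\<Sum>i=1..m. n i) * ?T n"
      by (simp only: mult.assoc[symmetric] FD_coeff_shift[OF c, where m=m and n=n and a=a and b=b, symmetric] distrib_right)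
  qed
qed

text \<open>The derivative relation eliminates the derivatives at \<open>a - 1\<close> from the
  Euler relation. A common factor \<open>a - 1\<close> then cancels, hence
  \<open>a \<noteq> 1\<close>.\<close>

lemma FD_contiguity:
  assumes b: "\<forall>l\<in>{1..m}. pochhammer (b l) K = 0" and c: "\<And>n. c + of_nat n \<noteq> 0"
    and a: "a \<noteq> 1"
  shows "(c - a) * lauricella_FD m (a - 1) b c x
       = (c - a - (\<Sum>i=1..m. b i * x i)) * lauricella_FD m a b c x
         + (\<Sum>i=1..m. x i * (1 - x i) * partial_deriv i (lauricella_FD m a b c) x)"
proof -
  define F where "F = lauricella_FD m a b c x"
  define F' where "F' = lauricella_FD m (a - 1) b c x"
  define D where "D i = partial_deriv i (lauricella_FD m a b c) x" for i
  define D' where "D' i = partial_deriv i (lauricella_FD m (a - 1) b c) x" for i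
  have "(\<Sum>i=1..m. (c - a) * (x i * D' i))
      = (\<Sum>i=1..m. (a - 1) * (b i * x i * F) - (a - 1) * (x i * (1 - x i) * D i))"
  proof (rule sum.cong[OF refl])
    fix i assume "i \<in> {1..m}"
    from FD_contiguity_deriv[OF b c this, where a=a and x=x]
    have "(c - a) * D' i = (a - 1) * (b i * F + x i * D i - D i)"
      by (simp add: F_def D_def D'_def)
    from arg_cong[OF this, of "\<lambda>y. x i * y"]
    show "(c - a) * (x i * D' i) = (a - 1) * (b i * x i * F) - (a - 1) * (x i * (1 - x i) * D i)"
      by (simp add: algebra_simps)
  qed
  then have 1: "(c - a) * (\<Sum>i=1..m. x i * D' i)
      = (a - 1) * ((\<Sum>i=1..m. b i * x i) * F) - (a - 1) * (\<Sum>i=1..m. x i * (1 - x i) * D i)"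
    unfolding sum_subtractf sum_distrib_left sum_distrib_right .
  have 2: "(a - 1) * F = (a - 1) * F' + (\<Sum>i=1..m. x i * D' i)"
    using FD_shift_eq_euler[OF b c, where a=a and x=x] by (simp add: F_def F'_def D'_def)
  have "(a - 1) * ((c - a) * F') = (a - 1) *
      ((c - a - (\<Sum>i=1..m. b i * x i)) * F + (\<Sum>i=1..m. x i * (1 - x i) * D i))"
  proof -
    have "(a - 1) * ((c - a) * F') = (c - a) * ((a - 1) * F) - (c - a) * (\<Sum>i=1..m. x i * D' i)"
      unfolding 2 by (simp only: algebra_simps)
    also have "\<dots> = (a - 1) *
        ((c - a - (\<Sum>i=1..m. b i * x i)) * F + (\<Sum>i=1..m. x i * (1 - x i) * D i))"
      unfolding 1 by (simp only: algebra_simps)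
    finally show ?thesis .
  qed
  then show ?thesis using a by (simp add: F_def F'_def D_def)
qed

subsection \<open>Contiguity of the Laurent polynomials \<open>f\<^sup>(\<^sup>k\<^sup>)\<close>\<close>

text \<open>The signed index sum shared by the exponent of \<open>x k\<close> and the last two Gamma
  factors; it can be negative, hence the type.\<close>

definition index_shift :: "nat \<Rightarrow> nat \<Rightarrow> (nat \<Rightarrow> nat) \<Rightarrow> int" where
  "index_shift m k n = (\<Sum>l=1..k. int (n l)) - (\<Sum>l=k+1..m. int (n l))"

text \<open>The powers in front of the series are absorbed here, so that each summand becomes a
  coefficient times a single Laurent monomial.\<close>

definition fk_exp :: "nat \<Rightarrow> nat \<Rightarrow> (nat \<Rightarrow> int) \<Rightarrow> int \<Rightarrow> (nat \<Rightarrow> nat) \<Rightarrow> nat \<Rightarrow> int" where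
  "fk_exp m k b c n l =
     (if l < k then - b l - int (n l)
      else if l = k then 1 + (\<Sum>j=1..<k. b j) - c + index_shift m k n
      else int (n l))"

lemma index_shift_Suc:
  assumes "i \<in> {1..m}"
  shows "index_shift m k (n(i := Suc (n i))) = index_shift m k n + (if i \<le> k then 1 else - 1)"
  using assms unfolding index_shift_def
  by (simp only: sum_fun_upd_Suc finite_atLeastAtMost) auto

section \<open>Shift relations for the Gamma coefficients\<close>

lemma recip_Gamma_k_eq:
  "recip_Gamma_k m k a b c n =
     rGamma (c - a - of_nat (n k)) *
     (\<Prod>l\<in>{1..m} - {k}. rGamma (1 - b l - of_nat (n l))) *
     (\<Prod>l=1..m. rGamma (1 + of_nat (n l))) *
     rGamma (c - (\<Sum>l=1..k. b l) - of_int (index_shift m k n)) *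
     rGamma (2 + (\<Sum>l=1..<k. b l) - c + of_int (index_shift m k n))"
  by (simp add: recip_Gamma_k_def index_shift_def algebra_simps)

lemma rGamma_minus: "(z - 1) * rGamma z = rGamma (z - 1 :: complex)"
  using rGamma_plus1[of "z - 1"] by simp

lemma recip_Gamma_k_prod_Suc:
  fixes n :: "nat \<Rightarrow> nat"
  assumes i: "i \<in> {1..m}"
  shows "of_nat (Suc (n i)) * (\<Prod>l=1..m. rGamma (1 + of_nat ((n(i := Suc (n i))) l)) :: complex)
       = (\<Prod>l=1..m. rGamma (1 + of_nat (n l)))"
proof -
  have "(\<Prod>l=1..m. rGamma (1 + of_nat ((n(i := Suc (n i))) l)) :: complex)
      = rGamma (1 + of_nat (Suc (n i))) * (\<Prod>l\<in>{1..m} - {i}. rGamma (1 + of_nat (n l)))"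
    using i by (intro prod_fun_upd) auto
  moreover have "(\<Prod>l=1..m. rGamma (1 + of_nat (n l)) :: complex)
      = rGamma (1 + of_nat (n i)) * (\<Prod>l\<in>{1..m} - {i}. rGamma (1 + of_nat (n l)))"
    using i by (subst prod.remove[of _ i]) auto
  moreover have "of_nat (Suc (n i)) * rGamma (1 + of_nat (Suc (n i))) = rGamma (1 + of_nat (n i) :: complex)"
    using rGamma_plus1[of "of_nat (Suc (n i)) :: complex"] by (simp add: add_ac)
  ultimately show ?thesis by (simp only: mult.assoc[symmetric])
qed

lemma recip_Gamma_k_prod_Suc':
  fixes n :: "nat \<Rightarrow> nat"
  assumes i: "i \<in> {1..m} - {k}"
  shows "(\<Prod>l\<in>{1..m} - {k}. rGamma (1 - b l - of_nat ((n(i := Suc (n i))) l)))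
       = (- b i - of_nat (n i)) * (\<Prod>l\<in>{1..m} - {k}. rGamma (1 - b l - of_nat (n l)) :: complex)"
proof -
  have "(\<Prod>l\<in>{1..m} - {k}. rGamma (1 - b l - of_nat ((n(i := Suc (n i))) l)) :: complex)
      = rGamma (1 - b i - of_nat (Suc (n i))) * (\<Prod>l\<in>{1..m} - {k} - {i}. rGamma (1 - b l - of_nat (n l)))"
    using i by (intro prod_fun_upd) auto
  moreover have "(\<Prod>l\<in>{1..m} - {k}. rGamma (1 - b l - of_nat (n l)) :: complex)
      = rGamma (1 - b i - of_nat (n i)) * (\<Prod>l\<in>{1..m} - {k} - {i}. rGamma (1 - b l - of_nat (n l)))"
    using i by (subst prod.remove[of _ i]) auto
  moreover have "rGamma (1 - b i - of_nat (Suc (n i))) = (- b i - of_nat (n i)) * rGamma (1 - b i - of_nat (n i))"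
    using rGamma_minus[of "1 - b i - of_nat (n i)"] by (simp add: algebra_simps)
  ultimately show ?thesis by (simp only: mult.assoc)
qed

text \<open>Lowering \<open>c\<close> by one changes the last two Gamma arguments just as raising
  \<open>n i\<close> does for \<open>i < k\<close>, and \<open>c - a\<close> is unchanged. Only the
  two factors belonging to \<open>i\<close> differ.\<close>

lemma recip_Gamma_k_less:
  assumes "k \<le> m" "i \<in> {1..<k}"
  shows "(- b i - of_nat (n i)) * recip_Gamma_k m k (a - 1) b (c - 1) n
       = of_nat (Suc (n i)) * recip_Gamma_k m k a b c (n(i := Suc (n i)))"
proof -
  have i: "i \<in> {1..m}" "i \<in> {1..m} - {k}" "i \<le> k" "k \<noteq> i" using assms by auto
  define W where "W = (\<Prod>l=1..m. rGamma (1 + of_nat ((n(i := Suc (n i))) l)) :: complex)"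
  show ?thesis
    unfolding recip_Gamma_k_eq index_shift_Suc[OF i(1)] recip_Gamma_k_prod_Suc'[OF i(2), where n=n]
      recip_Gamma_k_prod_Suc[OF i(1), where n=n, symmetric] W_def[symmetric]
    using i by (simp add: algebra_simps)
qed

text \<open>For \<open>i > k\<close> raising \<open>n i\<close> lowers \<open>index_shift\<close>,
  which compensates the lowering of \<open>c\<close>. Again only the factors belonging to
  \<open>i\<close> differ.\<close>

lemma recip_Gamma_k_greater:
  assumes "1 \<le> k" "i \<in> {k<..m}"
  shows "of_nat (Suc (n i)) * recip_Gamma_k m k (a - 1) b (c - 1) (n(i := Suc (n i)))
       = (- b i - of_nat (n i)) * recip_Gamma_k m k a b c n"
proof -
  have i: "i \<in> {1..m}" "i \<in> {1..m} - {k}" "\<not> i \<le> k" "k \<noteq> i" using assms by auto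
  define W where "W = (\<Prod>l=1..m. rGamma (1 + of_nat ((n(i := Suc (n i))) l)) :: complex)"
  show ?thesis
    unfolding recip_Gamma_k_eq index_shift_Suc[OF i(1)] recip_Gamma_k_prod_Suc'[OF i(2), where n=n]
      recip_Gamma_k_prod_Suc[OF i(1), where n=n, symmetric] W_def[symmetric]
    using i by (simp add: algebra_simps)
qed

text \<open>At fixed \<open>n\<close> the last two Gamma arguments move by one in opposite
  directions, and each move costs one linear factor.\<close>

lemma recip_Gamma_k_same:
  fixes n :: "nat \<Rightarrow> nat" and m k :: nat
  defines "s \<equiv> of_int (index_shift m k n)"
  shows "(2 + (\<Sum>l=1..<k. b l) - c + s) * recip_Gamma_k m k (a - 1) b (c - 1) n
       = (c - (\<Sum>l=1..k. b l) - s - 1) * recip_Gamma_k m k a b c n"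
proof -
  define u v where "u = c - (\<Sum>l=1..k. b l) - s" and "v = 2 + (\<Sum>l=1..<k. b l) - c + s"
  define R where "R = rGamma (c - a - of_nat (n k)) *
     (\<Prod>l\<in>{1..m} - {k}. rGamma (1 - b l - of_nat (n l))) * (\<Prod>l=1..m. rGamma (1 + of_nat (n l)))"
  have 1: "recip_Gamma_k m k a b c n = R * rGamma u * rGamma v"
    by (simp add: recip_Gamma_k_eq R_def u_def v_def s_def)
  have "c - 1 - (\<Sum>l=1..k. b l) - s = u - 1" "2 + (\<Sum>l=1..<k. b l) - (c - 1) + s = v + 1"
    "c - 1 - (a - 1) = c - a"
    by (auto simp: u_def v_def)
  then have 2: "recip_Gamma_k m k (a - 1) b (c - 1) n = R * rGamma (u - 1) * rGamma (v + 1)"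
    unfolding recip_Gamma_k_eq R_def s_def[symmetric] by (simp only:)
  have "v * (R * rGamma (u - 1) * rGamma (v + 1)) = R * rGamma (u - 1) * (v * rGamma (v + 1))"
    by (simp only: mult_ac)
  also have "\<dots> = (u - 1) * (R * rGamma u * rGamma v)"
    unfolding rGamma_plus1 rGamma_minus[symmetric] by (simp only: mult_ac)
  finally show ?thesis unfolding 1 2 u_def v_def .
qed

text \<open>As for \<open>i < k\<close>, the shifts of \<open>c\<close> and \<open>n k\<close> agree
  in the last two factors; what differs is the factorial of \<open>n k\<close> and the factor with
  argument \<open>c - a - of_nat (n k)\<close>.\<close>

lemma recip_Gamma_k_index:
  assumes k: "k \<in> {1..m}"
  shows "(c - a - 1 - of_nat (n k)) * recip_Gamma_k m k (a - 1) b (c - 1) n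
       = of_nat (Suc (n k)) * recip_Gamma_k m k a b c (n(k := Suc (n k)))"
proof -
  define W where "W = (\<Prod>l=1..m. rGamma (1 + of_nat ((n(k := Suc (n k))) l)) :: complex)"
  have 1: "(\<Prod>l\<in>{1..m} - {k}. rGamma (1 - b l - of_nat ((n(k := Suc (n k))) l)))
    = (\<Prod>l\<in>{1..m} - {k}. rGamma (1 - b l - of_nat (n l)))"
    by (rule prod.cong) auto
  have 2: "rGamma (c - a - of_nat (Suc (n k))) = (c - a - 1 - of_nat (n k)) * rGamma (c - a - of_nat (n k))"
    using rGamma_minus[of "c - a - of_nat (n k)"] by (simp add: algebra_simps)
  show ?thesis
    unfolding recip_Gamma_k_eq index_shift_Suc[OF k] 1 fun_upd_same 2
      recip_Gamma_k_prod_Suc[OF k, where n=n, symmetric] W_def[symmetric]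
    by (simp add: algebra_simps)
qed

section \<open>Exponents and expansion of \<open>f_k\<close> into Laurent monomials\<close>

lemma prod_powi_add_single:
  fixes x :: "'b \<Rightarrow> 'a::field"
  assumes "finite A" "p \<in> A" "x p \<noteq> 0"
  shows "(\<Prod>l\<in>A. x l powi (e l + (if l = p then 1 else 0))) = x p * (\<Prod>l\<in>A. x l powi e l)"
proof -
  have "(\<Prod>l\<in>A. x l powi (e l + (if l = p then 1 else 0)))
      = (\<Prod>l\<in>A. x l powi e l * (if l = p then x p else 1))"
    using assms by (intro prod.cong) (auto simp: power_int_add)
  then show ?thesis using assms by (simp add: prod.distrib mult.commute)
qed

text \<open>The unit vectors are placed on the side where they are added, so that both sides turn
  into products by \<open>prod_powi_add_single\<close>.\<close>

lemma fk_exp_Suc: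
  assumes "i \<in> {1..m}"
  shows "i \<le> k \<Longrightarrow> fk_exp m k b c (n(i := Suc (n i))) l + (if l = i then 1 else 0)
           = fk_exp m k b c n l + (if l = k then 1 else 0) + (if i = k \<and> l = k then 1 else 0)"
    and "i > k \<Longrightarrow> fk_exp m k b c (n(i := Suc (n i))) l + (if l = k then 1 else 0)
           = fk_exp m k b c n l + (if l = i then 1 else 0)"
  using assms by (auto simp: fk_exp_def index_shift_Suc)

lemma fk_exp_shift: "fk_exp m k b (c - 1) n l = fk_exp m k b c n l + (if l = k then 1 else 0)"
  by (auto simp: fk_exp_def)

text \<open>The quotients of variables have degree 0 and the prefactor has degree
  \<open>1 - c\<close>, so the total degree varies only with \<open>n k\<close>.\<close>

lemma sum_fk_exp:
  assumes k: "k \<in> {1..m}"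
  shows "(\<Sum>l=1..m. fk_exp m k b c n l) = 1 - c + int (n k)"
proof -
  have split: "{1..m} = {1..<k} \<union> ({k} \<union> {k+1..m})" and split': "{1..k} = insert k {1..<k}"
    using k by auto
  have "(\<Sum>l=1..m. fk_exp m k b c n l)
      = (\<Sum>l=1..<k. fk_exp m k b c n l) + (fk_exp m k b c n k + (\<Sum>l=k+1..m. fk_exp m k b c n l))"
    unfolding split by (subst sum.union_disjoint; (subst sum.union_disjoint)?) auto
  also have "(\<Sum>l=1..<k. fk_exp m k b c n l) = - (\<Sum>l=1..<k. b l) - (\<Sum>l=1..<k. int (n l))"
    by (simp add: fk_exp_def sum_subtractf sum_negf)
  also have "(\<Sum>l=k+1..m. fk_exp m k b c n l) = (\<Sum>l=k+1..m. int (n l))"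
    by (simp add: fk_exp_def)
  also have "fk_exp m k b c n k = 1 + (\<Sum>j=1..<k. b j) - c + (int (n k) + (\<Sum>l=1..<k. int (n l)))
       - (\<Sum>l=k+1..m. int (n l))"
    unfolding fk_exp_def index_shift_def split' by simp
  finally show ?thesis by simp
qed

text \<open>At integral exponents and nonzero \<open>x\<close> the principal powers are integer
  powers, and \<open>K\<close> cuts the series down to a box.\<close>

lemma f_k_eq:
  fixes b :: "nat \<Rightarrow> int" and c :: int
  assumes k: "k \<in> {1..m}" and x: "\<forall>l\<in>{1..m}. x l \<noteq> 0"
    and K: "\<forall>n. (\<exists>l\<in>{1..m}. n l \<ge> K) \<longrightarrow>
           recip_Gamma_k m k a (\<lambda>l. of_int (b l)) (of_int c) n = 0"
  shows "f_k m k a (\<lambda>l. of_int (b l)) (of_int c) x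
       = (\<Sum>n\<in>{1..m} \<rightarrow>\<^sub>E {..<K}. recip_Gamma_k m k a (\<lambda>l. of_int (b l)) (of_int c) n *
            (\<Prod>l=1..m. x l powi fk_exp m k b c n l))"
proof -
  let ?G = "recip_Gamma_k m k a (\<lambda>l. of_int (b l)) (of_int c)"
  have split: "{1..m} = {1..<k} \<union> ({k} \<union> {k+1..m})" and split': "{1..k} = insert k {1..<k}"
    using k by auto
  have xk: "x k \<noteq> 0" using x k by auto
  have powr1: "(\<Prod>l=1..<k. x l powr (- of_int (b l))) = (\<Prod>l=1..<k. x l powi (- b l))"
    using x k by (intro prod.cong) (auto simp flip: complex_powr_of_int)
  have powr2: "x k powr ((\<Sum>l=1..<k. of_int (b l)) - of_int c + 1)
      = x k powi (1 + (\<Sum>l=1..<k. b l) - c)"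
    using xk by (simp add: complex_powr_of_int[symmetric] algebra_simps)
  have summand: "(\<Prod>l=1..<k. x l powi (- b l)) * x k powi (1 + (\<Sum>l=1..<k. b l) - c) *
      ((\<Prod>l=1..<k. (x k / x l) ^ n l) * x k ^ n k * (\<Prod>l=k+1..m. (x l / x k) ^ n l))
      = (\<Prod>l=1..m. x l powi fk_exp m k b c n l)" for n
  proof -
    have p1: "(\<Prod>l=1..<k. (x k / x l) ^ n l)
        = x k ^ (\<Sum>l=1..<k. n l) * (\<Prod>l=1..<k. x l powi (- int (n l)))"
      by (simp add: power_sum power_mult_distrib power_inverse power_int_minus divide_inverse flip: prod.distrib)
    have p2: "(\<Prod>l=k+1..m. (x l / x k) ^ n l) = (\<Prod>l=k+1..m. x l ^ n l) / x k ^ (\<Sum>l=k+1..m. n l)"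
      by (simp add: power_sum power_divide prod_dividef)
    have p3: "(\<Prod>l=1..<k. x l powi fk_exp m k b c n l)
        = (\<Prod>l=1..<k. x l powi (- b l)) * (\<Prod>l=1..<k. x l powi (- int (n l)))"
      unfolding prod.distrib[symmetric]
    proof (rule prod.cong[OF refl])
      fix l assume "l \<in> {1..<k}"
      then show "x l powi fk_exp m k b c n l = x l powi (- b l) * x l powi (- int (n l))"
        using x k by (subst power_int_add[symmetric]) (auto simp: fk_exp_def)
    qed
    have p4: "(\<Prod>l=k+1..m. x l powi fk_exp m k b c n l) = (\<Prod>l=k+1..m. x l ^ n l)"
      by (intro prod.cong) (auto simp: fk_exp_def)
    have "fk_exp m k b c n k = 1 + (\<Sum>j=1..<k. b j) - c
        + int (\<Sum>l=1..<k. n l) + int (n k) - int (\<Sum>l=k+1..m. n l)"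
      unfolding fk_exp_def index_shift_def split' by simp
    then have p5: "x k powi fk_exp m k b c n k = x k powi (1 + (\<Sum>l=1..<k. b l) - c)
        * x k ^ (\<Sum>l=1..<k. n l) * x k ^ n k / x k ^ (\<Sum>l=k+1..m. n l)"
      using xk by (simp only: power_int_diff[OF disjI1] power_int_add[OF disjI1] power_int_of_nat not_False_eq_True)
    have "(\<Prod>l=1..m. x l powi fk_exp m k b c n l)
      = (\<Prod>l=1..<k. x l powi fk_exp m k b c n l) * (x k powi fk_exp m k b c n k
           * (\<Prod>l=k+1..m. x l powi fk_exp m k b c n l))"
      unfolding split by (subst prod.union_disjoint; (subst prod.union_disjoint)?) auto
    then show ?thesis
      unfolding p1 p2 p3 p4 p5 by (simp only: times_divide_eq_left times_divide_eq_right mult_ac)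
  qed
  have "(\<Sum>\<^sub>\<infinity>n\<in>multi_indices m. ?G n * (\<Prod>l=1..<k. (x k / x l) ^ n l) * x k ^ n k *
            (\<Prod>l=k+1..m. (x l / x k) ^ n l))
      = (\<Sum>n\<in>{1..m} \<rightarrow>\<^sub>E {..<K}. ?G n * (\<Prod>l=1..<k. (x k / x l) ^ n l) * x k ^ n k *
            (\<Prod>l=k+1..m. (x l / x k) ^ n l))"
  proof (rule infsum_multi_indices)
    fix n l assume "l \<in> {1..m}" "n l \<ge> K"
    then have "?G n = 0" using K by blast
    then show "?G n * (\<Prod>l=1..<k. (x k / x l) ^ n l) * x k ^ n k *
            (\<Prod>l=k+1..m. (x l / x k) ^ n l) = 0" by simp
  qed
  then show ?thesis
    unfolding f_k_def powr1 powr2 summand[symmetric]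
    by (simp only: sum_distrib_left mult_ac)
qed

lemma theta_f_k:
  fixes b :: "nat \<Rightarrow> int" and c :: int
  assumes k: "k \<in> {1..m}" and x: "\<forall>l\<in>{1..m}. x l \<noteq> 0" and i: "i \<in> {1..m}"
    and K: "\<forall>n. (\<exists>l\<in>{1..m}. n l \<ge> K) \<longrightarrow>
           recip_Gamma_k m k a (\<lambda>l. of_int (b l)) (of_int c) n = 0"
  shows "x i * partial_deriv i (f_k m k a (\<lambda>l. of_int (b l)) (of_int c)) x
       = (\<Sum>n\<in>{1..m} \<rightarrow>\<^sub>E {..<K}. of_int (fk_exp m k b c n i) *
           (recip_Gamma_k m k a (\<lambda>l. of_int (b l)) (of_int c) n *
            (\<Prod>l=1..m. x l powi fk_exp m k b c n l)))"
proof (rule partial_deriv_Laurent'[OF _ i])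
  show "finite ({1..m} \<rightarrow>\<^sub>E {..<K})" by (simp add: finite_PiE)
  show "x i \<noteq> 0 \<or> (\<forall>n\<in>{1..m} \<rightarrow>\<^sub>E {..<K}. fk_exp m k b c n i \<ge> 0)" using x i by blast
  \<comment> \<open>The Laurent form needs nonzero variables, which persists near
    \<open>x i\<close>.\<close>
  have "\<forall>\<^sub>F t in nhds (x i). t \<in> - {0}"
    using x i by (intro eventually_nhds_in_open) auto
  then show "\<forall>\<^sub>F t in nhds (x i). f_k m k a (\<lambda>l. of_int (b l)) (of_int c) (x(i := t))
      = (\<Sum>n\<in>{1..m} \<rightarrow>\<^sub>E {..<K}. recip_Gamma_k m k a (\<lambda>l. of_int (b l)) (of_int c) n *
            (\<Prod>l=1..m. (x(i := t)) l powi fk_exp m k b c n l))"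
  proof eventually_elim
    case (elim t)
    then have "\<forall>l\<in>{1..m}. (x(i := t)) l \<noteq> 0" using x by simp
    then show ?case by (rule f_k_eq[OF k _ K])
  qed
qed

lemma prod_fk_exp_shift:
  fixes x :: "nat \<Rightarrow> complex"
  assumes "k \<in> {1..m}" "x k \<noteq> 0"
  shows "(\<Prod>l=1..m. x l powi fk_exp m k b (c - 1) n l) = x k * (\<Prod>l=1..m. x l powi fk_exp m k b c n l)"
  unfolding fk_exp_shift by (rule prod_powi_add_single[where x=x, OF finite_atLeastAtMost assms])

lemma prod_fk_exp_Suc:
  fixes x :: "nat \<Rightarrow> complex" and b :: "nat \<Rightarrow> int" and c :: int
  assumes k: "k \<in> {1..m}" and x: "\<forall>l\<in>{1..m}. x l \<noteq> 0" and i: "i \<in> {1..m}"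
  defines "X \<equiv> \<lambda>n. \<Prod>l=1..m. x l powi fk_exp m k b c n l"
  shows "i < k \<Longrightarrow> x i * X (n(i := Suc (n i))) = x k * X n"
    and "i > k \<Longrightarrow> x k * X (n(i := Suc (n i))) = x i * X n"
    and "X (n(k := Suc (n k))) = x k * X n"
proof -
  have xi: "x i \<noteq> 0" and xk: "x k \<noteq> 0" using x i k by auto
  note single = prod_powi_add_single[where x=x, OF finite_atLeastAtMost, symmetric]
  show "x i * X (n(i := Suc (n i))) = x k * X n" if "i < k"
    unfolding X_def single[OF i xi] single[OF k xk]
    using fk_exp_Suc(1)[OF i] that by (intro prod.cong) auto
  show "x k * X (n(i := Suc (n i))) = x i * X n" if "i > k"
    unfolding X_def single[OF i xi] single[OF k xk]
    using fk_exp_Suc(2)[OF i] that by (intro prod.cong) auto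
  show "X (n(k := Suc (n k))) = x k * X n"
    unfolding X_def single[OF k xk]
    using fk_exp_Suc(1)[OF k, of k b c n] by (intro prod.cong) (auto simp: add.commute)
qed

text \<open>Both sides are multiplied by \<open>x i \<noteq> 0\<close> and compared over one box.
  The position of \<open>i\<close> relative to \<open>k\<close> decides which side is
  reindexed.\<close>

lemma f_k_contiguity_deriv:
  fixes b :: "nat \<Rightarrow> int" and c :: int and x :: "nat \<Rightarrow> complex"
  assumes k: "k \<in> {1..m}" and x: "\<forall>l\<in>{1..m}. x l \<noteq> 0" and i: "i \<in> {1..m}"
    and K: "\<forall>n. (\<exists>l\<in>{1..m}. n l \<ge> K) \<longrightarrow>
           recip_Gamma_k m k a (\<lambda>l. of_int (b l)) (of_int c) n = 0"
    and K': "\<forall>n. (\<exists>l\<in>{1..m}. n l \<ge> K) \<longrightarrow>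
           recip_Gamma_k m k (a - 1) (\<lambda>l. of_int (b l)) (of_int (c - 1)) n = 0"
  defines "f \<equiv> f_k m k a (\<lambda>l. of_int (b l)) (of_int c)"
    and "g \<equiv> f_k m k (a - 1) (\<lambda>l. of_int (b l)) (of_int (c - 1))"
  shows "partial_deriv i g x = - (of_int (b i) * f x + x i * partial_deriv i f x)"
proof -
  let ?S = "{1..m} \<rightarrow>\<^sub>E {..<K}"
  define G where "G = recip_Gamma_k m k a (\<lambda>l. of_int (b l)) (of_int c)"
  define G' where "G' = recip_Gamma_k m k (a - 1) (\<lambda>l. of_int (b l)) (of_int (c - 1))"
  define X where "X n = (\<Prod>l=1..m. x l powi fk_exp m k b c n l)" for n
  have xk: "x k \<noteq> 0" and xi: "x i \<noteq> 0" using x k i by auto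
  have f: "f x = (\<Sum>n\<in>?S. G n * X n)"
    unfolding f_def G_def X_def by (rule f_k_eq[OF k x K])
  have theta_f: "x i * partial_deriv i f x = (\<Sum>n\<in>?S. of_int (fk_exp m k b c n i) * (G n * X n))"
    unfolding f_def G_def X_def by (rule theta_f_k[OF k x i K])
  have theta_g: "x i * partial_deriv i g x
      = (\<Sum>n\<in>?S. of_int (fk_exp m k b (c - 1) n i) * (G' n * (x k * X n)))"
    unfolding g_def G'_def X_def prod_fk_exp_shift[where x=x, OF k xk, symmetric] by (rule theta_f_k[OF k x i K'])
  have rhs: "x i * - (of_int (b i) * f x + x i * partial_deriv i f x)
      = (\<Sum>n\<in>?S. of_int (- b i - fk_exp m k b c n i) * (G n * (x i * X n)))"
    unfolding f theta_f sum_distrib_left sum.distrib[symmetric] sum_negf[symmetric]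
    by (intro sum.cong) (auto simp: algebra_simps)
  have G0: "G n = 0" "G' n = 0" if "n i = K" for n
  proof -
    have "n i \<ge> K" using that by simp
    then show "G n = 0" "G' n = 0" using K K' i unfolding G_def G'_def by blast+
  qed
  consider "i < k" | "i = k" | "i > k" by linarith
  then have "x i * partial_deriv i g x = x i * - (of_int (b i) * f x + x i * partial_deriv i f x)"
  proof cases
    case 1
    \<comment> \<open>For \<open>i < k\<close> the exponent is \<open>- b i - int (n i)\<close>, so
      the right-hand weight is \<open>n i\<close>, which vanishes on the lower face; the right-hand
      side is the one to reindex.\<close>
    have "x i * partial_deriv i g x
        = (\<Sum>n\<in>?S. of_nat (Suc (n i)) * (G (n(i := Suc (n i))) * (x i * X (n(i := Suc (n i))))))"
      unfolding theta_g
    proof (rule sum.cong[OF refl])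
      fix n
      have "of_int (fk_exp m k b (c - 1) n i) * G' n = of_nat (Suc (n i)) * G (n(i := Suc (n i)))"
        using recip_Gamma_k_less[of k m i "\<lambda>l. of_int (b l)" n a "of_int c"] 1 k i
        by (simp add: G_def G'_def fk_exp_def)
      moreover have "x i * X (n(i := Suc (n i))) = x k * X n"
        unfolding X_def by (rule prod_fk_exp_Suc(1)[OF k x i 1])
      ultimately show "of_int (fk_exp m k b (c - 1) n i) * (G' n * (x k * X n))
          = of_nat (Suc (n i)) * (G (n(i := Suc (n i))) * (x i * X (n(i := Suc (n i)))))"
        by (simp only: mult.assoc[symmetric])
    qed
    also have "\<dots> = (\<Sum>n\<in>?S. of_nat (n i) * (G n * (x i * X n)))"
      by (rule sum_box_shift[symmetric]) (use i G0 in auto)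
    also have "\<dots> = x i * - (of_int (b i) * f x + x i * partial_deriv i f x)"
      unfolding rhs using 1 by (intro sum.cong) (auto simp: fk_exp_def)
    finally show ?thesis .
  next
    case 2
    show ?thesis
      unfolding rhs unfolding theta_g
    proof (rule sum.cong[OF refl])
      fix n
      \<comment> \<open>For \<open>i = k\<close> the two weights are exactly the linear factors of
        \<open>recip_Gamma_k_same\<close>, so terms match without a shift.\<close>
      have "{1..k} = insert k {1..<k}" using k by auto
      then have e: "of_int (fk_exp m k b (c - 1) n k)
            = 2 + (\<Sum>l=1..<k. of_int (b l)) - of_int c + of_int (index_shift m k n)"
          "(of_int (- b k - fk_exp m k b c n k) :: complex)
            = of_int c - (\<Sum>l=1..k. of_int (b l)) - of_int (index_shift m k n) - 1"
        by (simp_all add: fk_exp_def)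
      show "of_int (fk_exp m k b (c - 1) n i) * (G' n * (x k * X n))
          = of_int (- b i - fk_exp m k b c n i) * (G n * (x i * X n))"
        using recip_Gamma_k_same[where k=k and b="\<lambda>l. of_int (b l)" and c="of_int c" and m=m and n=n and a=a]
        unfolding 2 e G_def G'_def by (simp only: mult.assoc[symmetric] of_int_diff of_int_1)
    qed
  next
    case 3
    \<comment> \<open>For \<open>i > k\<close> the exponent is \<open>n i\<close> itself, so now the
      derivative of \<open>g\<close> is reindexed.\<close>
    define H where "H n = G' n * (x k * X n)" for n
    have "x i * partial_deriv i g x = (\<Sum>n\<in>?S. of_nat (n i) * H n)"
      unfolding theta_g H_def using 3 by (intro sum.cong) (auto simp: fk_exp_def)
    also have "\<dots> = (\<Sum>n\<in>?S. of_nat (Suc (n i)) * H (n(i := Suc (n i))))"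
      by (rule sum_box_shift) (use i G0 in \<open>auto simp: H_def\<close>)
    also have "\<dots> = x i * - (of_int (b i) * f x + x i * partial_deriv i f x)"
      unfolding rhs
    proof (rule sum.cong[OF refl])
      fix n
      have "of_nat (Suc (n i)) * G' (n(i := Suc (n i))) = of_int (- b i - fk_exp m k b c n i) * G n"
        using recip_Gamma_k_greater[of k i m n a "\<lambda>l. of_int (b l)" "of_int c"] 3 k i
        by (simp add: G_def G'_def fk_exp_def)
      moreover have "x k * X (n(i := Suc (n i))) = x i * X n"
        unfolding X_def by (rule prod_fk_exp_Suc(2)[OF k x i 3])
      ultimately show "of_nat (Suc (n i)) * H (n(i := Suc (n i)))
          = of_int (- b i - fk_exp m k b c n i) * (G n * (x i * X n))"
        by (simp only: H_def mult.assoc[symmetric])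
    qed
    finally show ?thesis .
  qed
  then show ?thesis using xi by simp
qed

text \<open>The summands are homogeneous of degree \<open>1 - c + int (n k)\<close>, so
  \<open>c - 1\<close> plus the Euler operator acts on \<open>f\<close> as multiplication by
  \<open>n k\<close>. A box shift in direction \<open>k\<close> then leads from \<open>f\<close> to
  \<open>g\<close>.\<close>

lemma f_k_shift_eq_euler:
  fixes b :: "nat \<Rightarrow> int" and c :: int and x :: "nat \<Rightarrow> complex"
  assumes k: "k \<in> {1..m}" and x: "\<forall>l\<in>{1..m}. x l \<noteq> 0"
    and K: "\<forall>n. (\<exists>l\<in>{1..m}. n l \<ge> K) \<longrightarrow>
           recip_Gamma_k m k a (\<lambda>l. of_int (b l)) (of_int c) n = 0"
    and K': "\<forall>n. (\<exists>l\<in>{1..m}. n l \<ge> K) \<longrightarrow>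
           recip_Gamma_k m k (a - 1) (\<lambda>l. of_int (b l)) (of_int (c - 1)) n = 0"
  defines "f \<equiv> f_k m k a (\<lambda>l. of_int (b l)) (of_int c)"
    and "g \<equiv> f_k m k (a - 1) (\<lambda>l. of_int (b l)) (of_int (c - 1))"
  shows "(1 - a) * g x = (of_int c - 1) * f x + (\<Sum>i=1..m. x i * partial_deriv i f x)
           + (\<Sum>i=1..m. x i * partial_deriv i g x)"
proof -
  let ?S = "{1..m} \<rightarrow>\<^sub>E {..<K}"
  define G where "G = recip_Gamma_k m k a (\<lambda>l. of_int (b l)) (of_int c)"
  define G' where "G' = recip_Gamma_k m k (a - 1) (\<lambda>l. of_int (b l)) (of_int (c - 1))"
  define X where "X n = (\<Prod>l=1..m. x l powi fk_exp m k b c n l)" for n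
  have xk: "x k \<noteq> 0" using x k by auto
  have f: "f x = (\<Sum>n\<in>?S. G n * X n)"
    unfolding f_def G_def X_def by (rule f_k_eq[OF k x K])
  have g: "g x = (\<Sum>n\<in>?S. G' n * (x k * X n))"
    unfolding g_def G'_def X_def prod_fk_exp_shift[where x=x, OF k xk, symmetric] by (rule f_k_eq[OF k x K'])
  have "(\<Sum>i=1..m. x i * partial_deriv i f x)
      = (\<Sum>i=1..m. \<Sum>n\<in>?S. of_int (fk_exp m k b c n i) * (G n * X n))"
    unfolding f_def G_def X_def by (rule sum.cong[OF refl], rule theta_f_k[OF k x _ K])
  also have "\<dots> = (\<Sum>n\<in>?S. of_int (\<Sum>i=1..m. fk_exp m k b c n i) * (G n * X n))"
    by (subst sum.swap) (simp add: sum_distrib_right)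
  finally have euler_f: "(\<Sum>i=1..m. x i * partial_deriv i f x)
      = (\<Sum>n\<in>?S. of_int (1 - c + int (n k)) * (G n * X n))"
    unfolding sum_fk_exp[OF k] .
  have "(\<Sum>i=1..m. x i * partial_deriv i g x)
      = (\<Sum>i=1..m. \<Sum>n\<in>?S. of_int (fk_exp m k b (c - 1) n i) * (G' n * (x k * X n)))"
    unfolding g_def G'_def X_def prod_fk_exp_shift[where x=x, OF k xk, symmetric]
    by (rule sum.cong[OF refl], rule theta_f_k[OF k x _ K'])
  also have "\<dots> = (\<Sum>n\<in>?S. of_int (\<Sum>i=1..m. fk_exp m k b (c - 1) n i) * (G' n * (x k * X n)))"
    by (subst sum.swap) (simp add: sum_distrib_right)
  finally have euler_g: "(\<Sum>i=1..m. x i * partial_deriv i g x)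
      = (\<Sum>n\<in>?S. of_int (1 - (c - 1) + int (n k)) * (G' n * (x k * X n)))"
    unfolding sum_fk_exp[OF k] .
  have "(of_int c - 1) * f x + (\<Sum>i=1..m. x i * partial_deriv i f x)
      = (\<Sum>n\<in>?S. of_nat (n k) * (G n * X n))"
    unfolding euler_f f sum_distrib_left sum.distrib[symmetric]
    by (intro sum.cong) (auto simp: algebra_simps)
  also have "\<dots> = (\<Sum>n\<in>?S. of_nat (Suc (n k)) * (G (n(k := Suc (n k))) * X (n(k := Suc (n k)))))"
  proof (rule sum_box_shift)
    fix n assume "n k = K"
    then have "n k \<ge> K" by simp
    then have "G n = 0" using K k unfolding G_def by blast
    then show "G n * X n = 0" by simp
  qed (use k in auto)
  also have "\<dots> = (\<Sum>n\<in>?S. (of_int c - a - 1 - of_nat (n k)) * (G' n * (x k * X n)))"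
  proof (rule sum.cong[OF refl])
    fix n
    have "of_nat (Suc (n k)) * G (n(k := Suc (n k))) = (of_int c - a - 1 - of_nat (n k)) * G' n"
      using recip_Gamma_k_index[OF k, of "of_int c" a n "\<lambda>l. of_int (b l)"]
      by (simp add: G_def G'_def)
    moreover have "X (n(k := Suc (n k))) = x k * X n"
      unfolding X_def by (rule prod_fk_exp_Suc(3)[OF k x k])
    ultimately show "of_nat (Suc (n k)) * (G (n(k := Suc (n k))) * X (n(k := Suc (n k))))
        = (of_int c - a - 1 - of_nat (n k)) * (G' n * (x k * X n))"
      by (simp only: mult.assoc[symmetric])
  qed
  \<comment> \<open>The weight \<open>c - a - 1 - n k\<close> is \<open>1 - a\<close> minus the
    degree \<open>2 - c + n k\<close> of the monomial in \<open>g\<close>.\<close>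
  also have "\<dots> = (1 - a) * g x - (\<Sum>i=1..m. x i * partial_deriv i g x)"
    unfolding euler_g g sum_distrib_left sum_subtractf[symmetric]
    by (intro sum.cong) (auto simp: algebra_simps)
  finally show ?thesis by simp
qed

text \<open>Inserting the derivative relation into the Euler relation removes the derivatives of
  \<open>g\<close>, and the Euler terms of \<open>f\<close> cancel.\<close>

lemma f_k_contiguity:
  fixes b :: "nat \<Rightarrow> int" and c :: int and x :: "nat \<Rightarrow> complex"
  assumes k: "k \<in> {1..m}" and x: "\<forall>l\<in>{1..m}. x l \<noteq> 0"
    and K: "\<forall>n. (\<exists>l\<in>{1..m}. n l \<ge> K) \<longrightarrow>
           recip_Gamma_k m k a (\<lambda>l. of_int (b l)) (of_int c) n = 0"
    and K': "\<forall>n. (\<exists>l\<in>{1..m}. n l \<ge> K) \<longrightarrow>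
           recip_Gamma_k m k (a - 1) (\<lambda>l. of_int (b l)) (of_int (c - 1)) n = 0"
  defines "f \<equiv> f_k m k a (\<lambda>l. of_int (b l)) (of_int c)"
    and "g \<equiv> f_k m k (a - 1) (\<lambda>l. of_int (b l)) (of_int (c - 1))"
  shows "(1 - a) * g x = (of_int c - 1 - (\<Sum>i=1..m. of_int (b i) * x i)) * f x
           + (\<Sum>i=1..m. x i * (1 - x i) * partial_deriv i f x)"
proof -
  have "(\<Sum>i=1..m. x i * partial_deriv i g x)
      = (\<Sum>i=1..m. x i * (1 - x i) * partial_deriv i f x - x i * partial_deriv i f x
           - of_int (b i) * x i * f x)"
  proof (rule sum.cong[OF refl])
    fix i assume i: "i \<in> {1..m}"
    have eq: "partial_deriv i g x = - (of_int (b i) * f x + x i * partial_deriv i f x)"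
      unfolding f_def g_def by (rule f_k_contiguity_deriv[OF k x i K K'])
    show "x i * partial_deriv i g x = x i * (1 - x i) * partial_deriv i f x
        - x i * partial_deriv i f x - of_int (b i) * x i * f x"
      unfolding eq by (simp add: algebra_simps)
  qed
  then have g: "(\<Sum>i=1..m. x i * partial_deriv i g x)
      = (\<Sum>i=1..m. x i * (1 - x i) * partial_deriv i f x) - (\<Sum>i=1..m. x i * partial_deriv i f x)
        - (\<Sum>i=1..m. of_int (b i) * x i) * f x"
    unfolding sum_subtractf sum_distrib_right .
  have "(1 - a) * g x = (of_int c - 1) * f x + (\<Sum>i=1..m. x i * partial_deriv i f x)
           + (\<Sum>i=1..m. x i * partial_deriv i g x)"
    unfolding f_def g_def by (rule f_k_shift_eq_euler[OF k x K K'])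
  then show ?thesis unfolding g by (simp add: algebra_simps)
qed

subsection \<open>Matrix form\<close>

lemma P_mat_mult_deriv_vec:
  assumes "a \<noteq> 0" "a \<noteq> 1" "c \<noteq> a" and b: "\<forall>j\<in>{1..m}. b j \<noteq> 0" and "c \<noteq> (\<Sum>j=1..m. b j)"
  shows "P_mat m k a b c x *\<^sub>v deriv_vec m b f x = Matrix.vec (m + 1) (\<lambda>i.
    if i = 0
    then (1 - x_ext m x k) * f x
         - ((c - a - (\<Sum>j=1..m. b j * x j)) * f x
             + (\<Sum>j=1..m. x j * (1 - x j) * partial_deriv j f x)) / (1 - a)
    else (1 - x i) * f x + (x i - x_ext m x k) * ((x i - 1) / (- b i) * partial_deriv i f x))"
proof -
  have "(\<Sum>j=1..m. x j * b j * deriv_vec m b f x $ j)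
      = (\<Sum>j=1..m. x j * (1 - x j) * partial_deriv j f x)"
    using b by (intro sum.cong) (auto simp: deriv_vec_def field_simps)
  moreover have "deriv_vec m b f x $ 0 = f x" by (simp add: deriv_vec_def)
  ultimately show ?thesis
    by (subst P_mat_mult_vec[OF assms]) (auto simp: deriv_vec_def)
qed

text \<open>For index \<open>m + 1\<close> the value of \<open>x_ext\<close> is 1, so the first term
  of row 0 disappears and row \<open>i\<close> carries the factor \<open>x i - 1\<close> of the
  derivative relation.\<close>

lemma F_vec_contiguity:
  assumes "a \<noteq> 0" and a: "a \<noteq> 1" and ca: "c \<noteq> a" and "\<forall>j\<in>{1..m}. b j \<noteq> 0" and "c \<noteq> (\<Sum>j=1..m. b j)"
    and b: "\<forall>j\<in>{1..m}. pochhammer (b j) K = 0" and c: "\<And>n. c + of_nat n \<noteq> 0"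
  shows "F_vec m (a - 1) b c x
      = ((a - 1) / (c - a)) \<cdot>\<^sub>v (P_mat m (m + 1) a b c x *\<^sub>v F_vec m a b c x)"
proof -
  let ?F = "lauricella_FD m a b c" and ?F' = "lauricella_FD m (a - 1) b c"
  have "?F' x = (a - 1) / (c - a) * - (((c - a - (\<Sum>j=1..m. b j * x j)) * ?F x
             + (\<Sum>j=1..m. x j * (1 - x j) * partial_deriv j ?F x)) / (1 - a))"
  proof -
    let ?R = "(c - a - (\<Sum>j=1..m. b j * x j)) * ?F x
             + (\<Sum>j=1..m. x j * (1 - x j) * partial_deriv j ?F x)"
    have "(c - a) * ?F' x = ?R" by (rule FD_contiguity[OF b c a])
    then have "?F' x = ?R / (c - a)" using ca by (simp add: nonzero_eq_divide_eq mult.commute)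
    moreover have "(a - 1) / (c - a) * - (r / (1 - a)) = r / (c - a)" for r
      using a by (simp add: divide_simps) (simp add: algebra_simps)
    ultimately show ?thesis by (simp only:)
  qed
  moreover have "(x i - 1) / (- b i) * partial_deriv i ?F' x = (a - 1) / (c - a) *
      ((1 - x i) * ?F x + (x i - 1) * ((x i - 1) / (- b i) * partial_deriv i ?F x))"
    if i: "i \<in> {1..m}" for i
  proof -
    have bi: "b i \<noteq> 0" using assms(4) i by auto
    have "partial_deriv i ?F' x = (c - a) * partial_deriv i ?F' x / (c - a)" using ca by simp
    also have "(c - a) * partial_deriv i ?F' x
        = (a - 1) * (b i * ?F x + x i * partial_deriv i ?F x - partial_deriv i ?F x)"
      by (rule FD_contiguity_deriv[OF b c i])
    finally have eq: "partial_deriv i ?F' x = (a - 1) * (b i * ?F x + x i * partial_deriv i ?F x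
        - partial_deriv i ?F x) / (c - a)" .
    have "(x i - 1) / (- b i) * partial_deriv i ?F' x = (a - 1) / (c - a) *
      ((x i - 1) / (- b i) * (b i * ?F x + x i * partial_deriv i ?F x - partial_deriv i ?F x))"
      unfolding eq by (simp add: mult_ac)
    also have "(x i - 1) / (- b i) * (b i * ?F x + x i * partial_deriv i ?F x - partial_deriv i ?F x)
        = (1 - x i) * ?F x + (x i - 1) * ((x i - 1) / (- b i) * partial_deriv i ?F x)"
      using bi by (simp add: field_simps)
    finally show ?thesis .
  qed
  ultimately show ?thesis
    unfolding F_vec_def P_mat_mult_deriv_vec[OF assms(1-5)]
    by (intro eq_vecI) (auto simp: deriv_vec_def x_ext_def)
qed

text \<open>For index 0 the value of \<open>x_ext\<close> is 0, so row \<open>i\<close> carries the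
  Euler term \<open>x i\<close> times the derivative.\<close>

lemma F_k_vec_contiguity:
  fixes b :: "nat \<Rightarrow> int" and c :: int
  defines "b' \<equiv> \<lambda>j. of_int (b j) :: complex"
  assumes "a \<noteq> 0" and a: "a \<noteq> 1" and "of_int c \<noteq> a" and b: "\<forall>j\<in>{1..m}. b' j \<noteq> 0"
    and "of_int c \<noteq> (\<Sum>j=1..m. b' j)"
    and k: "k \<in> {1..m}" and x: "\<forall>l\<in>{1..m}. x l \<noteq> 0"
    and K: "\<forall>n. (\<exists>l\<in>{1..m}. n l \<ge> K) \<longrightarrow> recip_Gamma_k m k a b' (of_int c) n = 0"
    and K': "\<forall>n. (\<exists>l\<in>{1..m}. n l \<ge> K) \<longrightarrow> recip_Gamma_k m k (a - 1) b' (of_int (c - 1)) n = 0"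
  shows "F_k_vec m k (a - 1) b' (of_int (c - 1)) x
       = - (P_mat m 0 a b' (of_int c) x *\<^sub>v F_k_vec m k a b' (of_int c) x)"
proof -
  let ?f = "f_k m k a b' (of_int c)" and ?g = "f_k m k (a - 1) b' (of_int (c - 1))"
  have "?g x = - (?f x - ((of_int c - a - (\<Sum>j=1..m. b' j * x j)) * ?f x
             + (\<Sum>j=1..m. x j * (1 - x j) * partial_deriv j ?f x)) / (1 - a))"
  proof -
    have "(1 - a) * ?g x = (of_int c - 1 - (\<Sum>j=1..m. b' j * x j)) * ?f x
             + (\<Sum>j=1..m. x j * (1 - x j) * partial_deriv j ?f x)"
      using f_k_contiguity[OF k x K[unfolded b'_def] K'[unfolded b'_def]] by (simp only: b'_def)
    \<comment> \<open>Writing \<open>c - 1\<close> as \<open>(c - a) - (1 - a)\<close> produces the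
      bracket in row 0 of the matrix product.\<close>
    also have "\<dots> = (of_int c - a - (\<Sum>j=1..m. b' j * x j)) * ?f x
             + (\<Sum>j=1..m. x j * (1 - x j) * partial_deriv j ?f x) - (1 - a) * ?f x"
      by (simp add: algebra_simps)
    finally have "?g x = \<dots> / (1 - a)" using a by (simp add: nonzero_eq_divide_eq mult.commute)
    then show ?thesis using a by (simp add: diff_divide_distrib)
  qed
  moreover have "(x i - 1) / (- b' i) * partial_deriv i ?g x
      = - ((1 - x i) * ?f x + x i * ((x i - 1) / (- b' i) * partial_deriv i ?f x))"
    if i: "i \<in> {1..m}" for i
  proof -
    have bi: "b' i \<noteq> 0" using b i by auto
    have eq: "partial_deriv i ?g x = - (b' i * ?f x + x i * partial_deriv i ?f x)"
      using f_k_contiguity_deriv[OF k x i K[unfolded b'_def] K'[unfolded b'_def]] by (simp only: b'_def)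
    show ?thesis unfolding eq using bi by (simp add: field_simps)
  qed
  ultimately show ?thesis
    unfolding F_k_vec_def P_mat_mult_deriv_vec[OF assms(2-6)]
    by (intro eq_vecI) (auto simp: deriv_vec_def x_ext_def)
qed

section \<open>Specialization to integral parameters\<close>

lemma rGamma_of_int_eq_0: "j \<le> 0 \<Longrightarrow> rGamma (of_int j :: complex) = 0"
  by (auto simp: rGamma_eq_zero_iff intro: nonpos_Ints_of_int)

text \<open>A large index puts one Gamma argument at a pole: the one with \<open>c - a\<close> if
  \<open>l = k\<close>, the one with \<open>1 - b l\<close> otherwise.\<close>

lemma recip_Gamma_k_of_int_eq_0:
  fixes b :: "nat \<Rightarrow> int" and d :: int
  assumes "c - a = of_int d" "d \<le> int K" "\<forall>l\<in>{1..m}. 1 - b l \<le> int K" "l \<in> {1..m}" "n l \<ge> K"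
  shows "recip_Gamma_k m k a (\<lambda>l. of_int (b l)) c n = 0"
proof (cases "l = k")
  case True
  have "rGamma (c - a - of_nat (n k)) = rGamma (of_int (d - int (n k)))"
    using assms(1) by simp
  also have "\<dots> = 0" using assms True by (intro rGamma_of_int_eq_0) auto
  finally show ?thesis by (simp add: recip_Gamma_k_def)
next
  case False
  have "rGamma (1 - of_int (b l) - of_nat (n l) :: complex) = rGamma (of_int (1 - b l - int (n l)))"
    by simp
  also have "\<dots> = 0" using assms by (intro rGamma_of_int_eq_0) force
  finally have "(\<Prod>l\<in>{1..m} - {k}. rGamma (1 - of_int (b l) - of_nat (n l) :: complex)) = 0"
    using False assms(4) by (intro prod_zero) auto
  then show ?thesis by (simp add: recip_Gamma_k_def)
qed

theorem proposition15:
  fixes m :: nat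
    and \<beta>1 \<beta>2 :: int
    and \<gamma> :: "nat \<Rightarrow> int"
    and a c :: complex
    and b :: "nat \<Rightarrow> complex"
  assumes "m \<ge> 1"
    and "\<beta>1 > 0" and "\<beta>2 > 0" and "\<forall>i\<in>{0..m}. \<gamma> i > 0"
    and "\<beta>1 + \<beta>2 = (\<Sum>i=0..m. \<gamma> i)"
    and "a = of_int (- \<beta>1)"
    and "b = (\<lambda>j. of_int (- \<gamma> j))"
    and "c = of_int (\<gamma> 0 - \<beta>1 + 1)"
  shows "((\<beta>1, \<beta>2, \<gamma>) \<in> \<B> m 0 \<longrightarrow>
            (\<forall>x :: nat \<Rightarrow> complex.
               F_vec m (a - 1) b c x
                 = ((a - 1) / (c - a)) \<cdot>\<^sub>v (P_mat m (m + 1) a b c x *\<^sub>v F_vec m a b c x)))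
       \<and> (\<forall>k\<in>{1..m}.
            (\<beta>1, \<beta>2, \<gamma>) \<in> \<B> m k \<and> (\<beta>1 + 1, \<beta>2 - 1, \<gamma>) \<in> \<B> m k \<longrightarrow>
            (\<forall>x :: nat \<Rightarrow> complex. (\<forall>i\<in>{1..m}. x i \<noteq> 0) \<longrightarrow>
               F_k_vec m k (a - 1) b (c - 1) x
                 = - (P_mat m 0 a b c x *\<^sub>v F_k_vec m k a b c x)))"
proof -
  define b' where "b' j = - \<gamma> j" for j
  define c' where "c' = \<gamma> 0 - \<beta>1 + 1"
  have bb: "b = (\<lambda>j. of_int (b' j))" and cc: "c = of_int c'"
    using assms by (simp_all add: b'_def c'_def)
  \<comment> \<open>One bound for all indices; \<open>\<gamma> 0\<close> is included because
    \<open>c - a = \<gamma> 0 + 1\<close> limits \<open>n k\<close>.\<close>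
  obtain K :: nat where K: "\<forall>l\<in>{0..m}. \<gamma> l < int K"
  proof
    show "\<forall>l\<in>{0..m}. \<gamma> l < int (nat (Max (\<gamma> ` {0..m}) + 1))"
    proof
      fix l assume l: "l \<in> {0..m}"
      then have "\<gamma> l \<le> Max (\<gamma> ` {0..m})" by (intro Max_ge) auto
      moreover have "\<gamma> l > 0" using assms(4) l by blast
      ultimately show "\<gamma> l < int (nat (Max (\<gamma> ` {0..m}) + 1))" by linarith
    qed
  qed
  have a: "a \<noteq> 0" "a \<noteq> 1"
  proof -
    have "- \<beta>1 \<noteq> 0" "- \<beta>1 \<noteq> 1" using assms(2) by auto
    then show "a \<noteq> 0" "a \<noteq> 1" unfolding assms(6) by (metis of_int_eq_0_iff, metis of_int_eq_1_iff)
  qed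
  have ca_eq: "c - a = of_int (\<gamma> 0 + 1)" using assms by simp
  have ca: "c \<noteq> a"
  proof -
    have "\<gamma> 0 + 1 \<noteq> 0" using assms(4) by force
    then have "c - a \<noteq> 0" unfolding ca_eq by (metis of_int_eq_0_iff)
    then show ?thesis by simp
  qed
  have b: "\<forall>j\<in>{1..m}. b j \<noteq> 0" using assms(4,7) by force
  \<comment> \<open>The balance condition turns the difference into \<open>\<beta>2 + 1\<close>,
    which is positive.\<close>
  have c: "c \<noteq> (\<Sum>j=1..m. b j)"
  proof -
    have "(\<Sum>i=0..m. \<gamma> i) = \<gamma> 0 + (\<Sum>i=1..m. \<gamma> i)" by (simp add: sum.atLeast_Suc_atMost)
    then have "c' - (\<Sum>j=1..m. b' j) = \<beta>2 + 1"
      using assms(5) by (simp add: c'_def b'_def sum_negf)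
    then have "c - (\<Sum>j=1..m. b j) = of_int (\<beta>2 + 1)"
      unfolding bb cc by (metis of_int_diff of_int_sum)
    moreover have "\<beta>2 + 1 \<noteq> 0" using assms(3) by simp
    ultimately have "c - (\<Sum>j=1..m. b j) \<noteq> 0" by (metis of_int_eq_0_iff)
    then show ?thesis by simp
  qed
  have "F_vec m (a - 1) b c x
      = ((a - 1) / (c - a)) \<cdot>\<^sub>v (P_mat m (m + 1) a b c x *\<^sub>v F_vec m a b c x)"
    if "(\<beta>1, \<beta>2, \<gamma>) \<in> \<B> m 0" for x
  proof (rule F_vec_contiguity[OF a ca b c])
    show "\<forall>l\<in>{1..m}. pochhammer (b l) K = 0"
    proof
      fix l assume l: "l \<in> {1..m}"
      then have "\<gamma> l > 0" "\<gamma> l < int K" using assms(4) K by auto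
      then have "b l = - of_nat (nat (\<gamma> l))" "nat (\<gamma> l) < K"
        using assms(7) by auto
      then show "pochhammer (b l) K = 0" by (simp add: pochhammer_of_nat_eq_0_lemma)
    qed
    \<comment> \<open>Membership in \<open>\<B> m 0\<close> gives
      \<open>\<beta>1 \<le> \<gamma> 0\<close>, hence \<open>c\<close> is a positive
      integer.\<close>
    show "c + of_nat n \<noteq> 0" for n
    proof -
      have "c' + int n \<noteq> 0" using that by (auto simp: \<B>_def c'_def)
      then show ?thesis unfolding cc by (metis of_int_add of_int_eq_0_iff of_int_of_nat_eq)
    qed
  qed
  moreover have "F_k_vec m k (a - 1) b (c - 1) x
      = - (P_mat m 0 a b c x *\<^sub>v F_k_vec m k a b c x)"
    if k: "k \<in> {1..m}" and x: "\<forall>i\<in>{1..m}. x i \<noteq> 0" for k x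
  proof -
    have c1: "c - 1 = of_int (c' - 1)" by (simp add: cc)
    \<comment> \<open>The strict bound on \<open>\<gamma>\<close> absorbs the 1 in
      \<open>1 - b' l\<close> and in \<open>c - a\<close>.\<close>
    have "\<gamma> l + 1 \<le> int K" if "l \<in> {0..m}" for l using bspec[OF K that] by linarith
    then have bounds: "\<gamma> 0 + 1 \<le> int K" "\<forall>l\<in>{1..m}. 1 - b' l \<le> int K"
      by (auto simp: b'_def add.commute)
    have "\<forall>n. (\<exists>l\<in>{1..m}. n l \<ge> K) \<longrightarrow> recip_Gamma_k m k a (\<lambda>j. of_int (b' j)) (of_int c') n = 0"
      using recip_Gamma_k_of_int_eq_0[OF ca_eq bounds] unfolding cc by blast
    moreover have "\<forall>n. (\<exists>l\<in>{1..m}. n l \<ge> K) \<longrightarrow>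
        recip_Gamma_k m k (a - 1) (\<lambda>j. of_int (b' j)) (of_int (c' - 1)) n = 0"
    proof -
      \<comment> \<open>Lowering \<open>a\<close> and \<open>c\<close> together keeps
        \<open>c - a\<close>, so the same box serves the shifted series.\<close>
      have "c - 1 - (a - 1) = of_int (\<gamma> 0 + 1)" using ca_eq by simp
      from recip_Gamma_k_of_int_eq_0[OF this bounds] show ?thesis unfolding c1 by blast
    qed
    ultimately show ?thesis
      unfolding c1 unfolding bb cc
      using F_k_vec_contiguity a ca b c k x unfolding bb cc by blast
  qed
  ultimately show ?thesis by blast
qed

end
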